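(* Let $c_0,c_h\in\mathbb{R}$ be constants and consider, for sufficiently smooth fields $Z(\mathbf{x},t)\in\mathbb{R}$ and $\mathbf{A}(\mathbf{x},t)\in\mathbb{R}^3$ on $\Omega\times[t_0,t_1]$ with $\Omega\subset\mathbb{R}^3$, the action $$\mathcal{A}[Z,\mathbf{A}]=\int_{t_0}^{t_1}\int_\Omega \Lambda\,\mathrm{d}\Omega\,\mathrm{d}t,\qquad \Lambda=\tfrac12\Big(Z_t^2+\|\mathbf{A}_t\|^2-\|c_0\nabla Z+c_h\nabla\times\mathbf{A}\|^2-c_h^2(\nabla\cdot\mathbf{A})^2\Big).$$ If $(Z,\mathbf{A})$ satisfies the Euler--Lagrange equations of $\mathcal{A}$ with respect to $Z$ and $\mathbf{A}$, then the fields $$T=-Z_t,\qquad \boldsymbol{\psi}=-\mathbf{A}_t,\qquad \mathbf{J}=c_0\nabla Z+c_h\nabla\times\mathbf{A},\qquad \varphi=c_h\nabla\cdot\mathbf{A}$$ satisfy the reversible heat-GLM system $$\partial_t T+c_0\nabla\cdot\mathbf{J}=0,\qquad \partial_t\mathbf{J}+c_0\nabla T+c_h\nabla\times\boldsymbol{\psi}=0,$$ $$\partial_t\boldsymbol{\psi}-c_h\nabla\times\mathbf{J}+c_h\nabla\varphi=0,\qquad \partial_t\varphi+c_h\nabla\cdot\boldsymbol{\psi}=0.$$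
   Context: Subscript $t$ denotes the partial time derivative and $\|\cdot\|$ the Euclidean norm. The Euler--Lagrange equations are the conditions expressing that the first variation of $\mathcal{A}$ vanishes for all smooth variations $\delta Z$, $\delta\mathbf{A}$ compactly supported in the interior of $\Omega\times(t_0,t_1)$. *)

theory Defs
  imports "HOL-Analysis.Analysis"
begin

section \<open>Classical smoothness\<close>

text \<open>On an open set, all directional derivatives up to order n exist and are continuous,
  and every derivative of order below n is again Frechet differentiable; for finite-dimensional
  domains this is the usual class of n times continuously differentiable functions.\<close>

primrec Ck_open :: "nat \<Rightarrow> 'a::real_normed_vector set \<Rightarrow> ('a \<Rightarrow> 'b::real_normed_vector) \<Rightarrow> bool" where
  "Ck_open 0 U f \<longleftrightarrow> continuous_on U f"
| "Ck_open (Suc n) U f \<longleftrightarrow> (\<forall>x\<in>U. f differentiable (at x)) \<and>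
     (\<forall>v. Ck_open n U (\<lambda>x. frechet_derivative f (at x) v))"

text \<open>On a set that need not be open, a function is of class n if it is so on some open
  neighbourhood of the set. Derivatives at boundary points are thereby ordinary two-sided ones;
  on the closure of the interior they depend on the values in the interior only.\<close>

definition Ck_on :: "nat \<Rightarrow> 'a::real_normed_vector set \<Rightarrow> ('a \<Rightarrow> 'b::real_normed_vector) \<Rightarrow> bool" where
  "Ck_on n S f \<longleftrightarrow> (\<exists>U. open U \<and> S \<subseteq> U \<and> Ck_open n U f)"

definition test_function :: "'a::real_normed_vector set \<Rightarrow> ('a \<Rightarrow> 'b::real_normed_vector) \<Rightarrow> bool" where
  "test_function V f \<longleftrightarrow> (\<forall>n. Ck_open n UNIV f) \<and>
     compact (closure {p. f p \<noteq> 0}) \<and> closure {p. f p \<noteq> 0} \<subseteq> V"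

section \<open>Differential operators\<close>

definition dt :: "('x \<Rightarrow> real \<Rightarrow> 'b::real_normed_vector) \<Rightarrow> 'x \<Rightarrow> real \<Rightarrow> 'b" where
  "dt F x t = vector_derivative (\<lambda>s. F x s) (at t)"

definition partial :: "3 \<Rightarrow> (real^3 \<Rightarrow> real) \<Rightarrow> real^3 \<Rightarrow> real" where
  "partial i f x = vector_derivative (\<lambda>h. f (x + h *\<^sub>R axis i 1)) (at 0)"

definition grad :: "(real^3 \<Rightarrow> real) \<Rightarrow> real^3 \<Rightarrow> real^3" where
  "grad f x = (\<chi> i. partial i f x)"

definition div3 :: "(real^3 \<Rightarrow> real^3) \<Rightarrow> real^3 \<Rightarrow> real" where
  "div3 F x = (\<Sum>i\<in>UNIV. partial i (\<lambda>y. F y $ i) x)"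

definition curl :: "(real^3 \<Rightarrow> real^3) \<Rightarrow> real^3 \<Rightarrow> real^3" where
  "curl F x = vector
     [partial 2 (\<lambda>y. F y $ 3) x - partial 3 (\<lambda>y. F y $ 2) x,
      partial 3 (\<lambda>y. F y $ 1) x - partial 1 (\<lambda>y. F y $ 3) x,
      partial 1 (\<lambda>y. F y $ 2) x - partial 2 (\<lambda>y. F y $ 1) x]"

section \<open>The action and its Euler--Lagrange equations\<close>

definition Lagrangian :: "real \<Rightarrow> real \<Rightarrow> (real^3 \<Rightarrow> real \<Rightarrow> real) \<Rightarrow> (real^3 \<Rightarrow> real \<Rightarrow> real^3)
    \<Rightarrow> real^3 \<Rightarrow> real \<Rightarrow> real" where
  "Lagrangian c0 ch Z A x t = 1/2 * ((dt Z x t)\<^sup>2 + (norm (dt A x t))\<^sup>2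
     - (norm (c0 *\<^sub>R grad (\<lambda>y. Z y t) x + ch *\<^sub>R curl (\<lambda>y. A y t) x))\<^sup>2
     - ch\<^sup>2 * (div3 (\<lambda>y. A y t) x)\<^sup>2)"

definition action :: "real \<Rightarrow> real \<Rightarrow> (real^3) set \<Rightarrow> real \<Rightarrow> real
    \<Rightarrow> (real^3 \<Rightarrow> real \<Rightarrow> real) \<Rightarrow> (real^3 \<Rightarrow> real \<Rightarrow> real^3) \<Rightarrow> real" where
  "action c0 ch \<Omega> t0 t1 Z A =
     (LINT t:{t0..t1}|lborel. (LINT x:\<Omega>|lborel. Lagrangian c0 ch Z A x t))"

text \<open>Isabelle's integral is 0 for non-integrable integrands, so that the action of a pair of
  fields is meaningful only under the following condition. It is automatic for bounded Borel
  \<Omega> and fields that are continuously differentiable on the closure of the space-time domain.\<close>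

definition finite_action :: "real \<Rightarrow> real \<Rightarrow> (real^3) set \<Rightarrow> real \<Rightarrow> real
    \<Rightarrow> (real^3 \<Rightarrow> real \<Rightarrow> real) \<Rightarrow> (real^3 \<Rightarrow> real \<Rightarrow> real^3) \<Rightarrow> bool" where
  "finite_action c0 ch \<Omega> t0 t1 Z A \<longleftrightarrow>
     set_integrable lborel (\<Omega> \<times> {t0..t1}) (\<lambda>(x, t). Lagrangian c0 ch Z A x t)"

definition Euler_Lagrange :: "real \<Rightarrow> real \<Rightarrow> (real^3) set \<Rightarrow> real \<Rightarrow> real
    \<Rightarrow> (real^3 \<Rightarrow> real \<Rightarrow> real) \<Rightarrow> (real^3 \<Rightarrow> real \<Rightarrow> real^3) \<Rightarrow> bool" where
  "Euler_Lagrange c0 ch \<Omega> t0 t1 Z A \<longleftrightarrow>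
     (\<forall>\<delta>Z \<delta>A.
        test_function (interior (\<Omega> \<times> {t0<..<t1})) (\<lambda>(x, t). \<delta>Z x t) \<longrightarrow>
        test_function (interior (\<Omega> \<times> {t0<..<t1})) (\<lambda>(x, t). \<delta>A x t) \<longrightarrow>
        ((\<lambda>\<epsilon>. action c0 ch \<Omega> t0 t1
                (\<lambda>x t. Z x t + \<epsilon> * \<delta>Z x t) (\<lambda>x t. A x t + \<epsilon> *\<^sub>R \<delta>A x t))
           has_real_derivative 0) (at 0))"

end

(* The action of (Z + e dZ, A + e dA) is a quadratic polynomial in e, so the Euler-Lagrange equations
   say that its linear coefficient vanishes. It suffices to test with dZ = b f and dA = f c for a scalar
   bump f and constants b and c, because curl (f c) = (grad f) x c turns the linear coefficient into the
   integral of wt f_t + w . grad f. Integration by parts and the fundamental lemma then give the wave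
   equations Z_tt = c0 div J and A_tt = - ch curl J + ch grad phi in the interior, and by continuity on
   all of the domain; these are the first and third equations of the system. The other two only express
   that mixed second derivatives commute. *)

theory Submission
  imports Defs
begin

section \<open>Directional derivatives and classes of differentiability\<close>

text \<open>The fields are only C2, so \<open>J\<close> and \<open>ch * div A\<close> are only C1;
  the linear coefficient is integrated by parts exactly once, onto fluxes that are C1. Time and
  space are treated alike: everything is expressed by directional Frechet derivatives
  \<open>D v\<close> on the space-time product, with \<open>A\<close> split into scalar components,
  and the weak equations become one statement about a four-dimensional divergence. As test functions
  have compact support, integration by parts reduces to a fact on the whole space: a directional
  derivative of a compactly supported C1 function has integral zero, by translation invariance of
  Lebesgue measure. The delicate object is the action, an iterated integral that is 0 by default
  where integrability fails, so the quadratic expansion must be justified for every e.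
  \<open>finite_action\<close> provides the constant term; the other two coefficients are continuous
  on the support of f and vanish outside it. The passage to boundary points rests on derivatives
  being two-sided in an open neighbourhood \<open>U\<close>, and on the domain lying in the closure
  of its interior.\<close>

abbreviation D :: "'a::real_normed_vector \<Rightarrow> ('a \<Rightarrow> 'b::real_normed_vector) \<Rightarrow> 'a \<Rightarrow> 'b" where
  "D v f \<equiv> (\<lambda>p. frechet_derivative f (at p) v)"

lemma D_eqI: "(f has_derivative f') (at p) \<Longrightarrow> D v f p = f' v"
  by (metis frechet_derivative_at)

lemma D_cong:
  assumes "open U" "p \<in> U" "\<And>q. q \<in> U \<Longrightarrow> f q = g q" "f differentiable at p"
  shows "D v f p = D v g p"
  using frechet_derivative_transform_within_open[OF assms(4,1,2,3)] by simp

lemma differentiable_cong: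
  assumes "open U" "p \<in> U" "\<And>q. q \<in> U \<Longrightarrow> f q = g q" "f differentiable at p"
  shows "g differentiable at p"
  using assms unfolding differentiable_def
  by (metis has_derivative_transform_within_open)

lemma Ck_open_cong:
  assumes "open U" "\<And>q. q \<in> U \<Longrightarrow> f q = g q" "Ck_open n U f"
  shows "Ck_open n U g"
  using assms(2,3)
proof (induction n arbitrary: f g)
  case 0
  then show ?case using continuous_on_cong by fastforce
next
  case (Suc n)
  have "g differentiable at p" if "p \<in> U" for p
    using differentiable_cong[OF assms(1) that, of f g] Suc.prems that by auto
  moreover have "Ck_open n U (D v g)" for v
    by (rule Suc.IH[of "D v f"]) (use D_cong[OF assms(1), of _ f g] Suc.prems in auto)
  ultimately show ?case by simp
qed

lemma Ck_open_subset: "Ck_open n U f \<Longrightarrow> V \<subseteq> U \<Longrightarrow> Ck_open n V f"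
  by (induction n arbitrary: f) (auto intro: continuous_on_subset)

text \<open>Continuity enters the recursion only at order 0, so nestedness of the classes has to be
  derived; at the bottom it is the continuity of differentiable functions.\<close>

lemma Ck_open_SucD: "Ck_open (Suc n) U f \<Longrightarrow> Ck_open n U f"
proof (induction n arbitrary: f)
  case 0
  then show ?case
    by (auto intro!: continuous_at_imp_continuous_on differentiable_imp_continuous_within)
next
  case (Suc n)
  show ?case
    unfolding Ck_open.simps(2)[of n] using Suc.prems Suc.IH unfolding Ck_open.simps(2)[of "Suc n"] by blast
qed

lemma Ck_open_continuous: "Ck_open n U f \<Longrightarrow> continuous_on U f"
  by (induction n) (simp, metis Ck_open_SucD)

lemma Ck_open_differentiable: "Ck_open (Suc n) U f \<Longrightarrow> p \<in> U \<Longrightarrow> f differentiable at p"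
  by simp

lemma Ck_open_D: "Ck_open (Suc n) U f \<Longrightarrow> Ck_open n U (D v f)"
  by simp

lemma Ck_open_const: "Ck_open n U (\<lambda>_. c)"
proof (induction n arbitrary: c)
  case (Suc n)
  have "D v (\<lambda>_::'a. c) = (\<lambda>_. 0)" for v
    by (intro ext D_eqI[of _ "\<lambda>_. 0"]) simp
  then show ?case using Suc by auto
qed simp

text \<open>The rule for inductions on the order: an explicit formula for the derivative, valid on
  \<open>U\<close> only, may replace \<open>frechet_derivative\<close>, because on an open set the
  class depends on the values there alone.\<close>

lemma Ck_open_SucI:
  assumes "open U" "\<And>p. p \<in> U \<Longrightarrow> (f has_derivative (\<lambda>v. f' v p)) (at p)" "\<And>v. Ck_open n U (f' v)"
  shows "Ck_open (Suc n) U f"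
proof -
  have "D v f p = f' v p" if "p \<in> U" for p v
    using assms(2)[OF that] by (rule D_eqI)
  then have "Ck_open n U (D v f)" for v
    using Ck_open_cong[OF assms(1) _ assms(3), of v "D v f"] by simp
  then show ?thesis using assms(2) by (auto simp: differentiable_def)
qed

lemma has_derivative_D: "f differentiable at p \<Longrightarrow> (f has_derivative (\<lambda>v. D v f p)) (at p)"
  by (simp add: frechet_derivative_works)

lemma Ck_open_add:
  "open U \<Longrightarrow> Ck_open n U f \<Longrightarrow> Ck_open n U g \<Longrightarrow> Ck_open n U (\<lambda>p. f p + g p)"
proof (induction n arbitrary: f g)
  case (Suc n)
  show ?case
  proof (rule Ck_open_SucI[where f' = "\<lambda>v p. D v f p + D v g p"])
    show "((\<lambda>p. f p + g p) has_derivative (\<lambda>v. D v f p + D v g p)) (at p)" if "p \<in> U" for p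
      by (rule has_derivative_add; rule has_derivative_D) (use Suc.prems that in simp_all)
    show "Ck_open n U (\<lambda>p. D v f p + D v g p)" for v
      by (rule Suc.IH) (use Suc.prems in simp_all)
  qed (fact Suc.prems(1))
qed (simp add: continuous_on_add)

lemma Ck_open_bounded_linear:
  assumes "bounded_linear L" "open U"
  shows "Ck_open n U f \<Longrightarrow> Ck_open n U (\<lambda>p. L (f p))"
proof (induction n arbitrary: f)
  case 0
  then show ?case by (simp add: bounded_linear.continuous_on[OF assms(1)])
next
  case (Suc n)
  show ?case
  proof (rule Ck_open_SucI[where f' = "\<lambda>v p. L (D v f p)"])
    show "((\<lambda>p. L (f p)) has_derivative (\<lambda>v. L (D v f p))) (at p)" if "p \<in> U" for p
      by (rule bounded_linear.has_derivative[OF assms(1)], rule has_derivative_D)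
         (use Suc.prems that in simp)
    show "Ck_open n U (\<lambda>p. L (D v f p))" for v
      by (rule Suc.IH) (use Suc.prems in simp)
  qed (fact assms(2))
qed

lemma Ck_open_mult:
  fixes f g :: "'a::real_normed_vector \<Rightarrow> real"
  shows "open U \<Longrightarrow> Ck_open n U f \<Longrightarrow> Ck_open n U g \<Longrightarrow> Ck_open n U (\<lambda>p. f p * g p)"
proof (induction n arbitrary: f g)
  case (Suc n)
  show ?case
  proof (rule Ck_open_SucI[where f' = "\<lambda>v p. f p * D v g p + D v f p * g p"])
    show "((\<lambda>p. f p * g p) has_derivative (\<lambda>v. f p * D v g p + D v f p * g p)) (at p)" if "p \<in> U" for p
      by (rule has_derivative_mult; rule has_derivative_D) (use Suc.prems that in simp_all)
    show "Ck_open n U (\<lambda>p. f p * D v g p + D v f p * g p)" for v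
      by (intro Ck_open_add Suc.IH Suc.prems(1) Ck_open_D Ck_open_SucD[OF Suc.prems(2)]
          Ck_open_SucD[OF Suc.prems(3)] Suc.prems(2,3))
  qed (fact Suc.prems(1))
qed (simp add: continuous_on_mult)

section \<open>Symmetry of second derivatives\<close>

lemma continuous_on_open_near:
  fixes g :: "'a::metric_space \<Rightarrow> real"
  assumes "open U" "continuous_on U g" "p \<in> U" "e > 0"
  shows "\<exists>r>0. ball p r \<subseteq> U \<and> (\<forall>q\<in>ball p r. \<bar>g q - g p\<bar> < e)"
proof -
  obtain d where d: "d > 0" "\<And>q. q \<in> U \<Longrightarrow> dist q p < d \<Longrightarrow> \<bar>g q - g p\<bar> < e"
    using assms(2-4) unfolding continuous_on_iff dist_real_def by meson
  obtain d' where "d' > 0" "ball p d' \<subseteq> U" using assms(1,3) open_contains_ball by blast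
  with d show ?thesis
    by (intro exI[of _ "min d d'"]) (auto simp: dist_commute subset_iff)
qed

text \<open>Reduces \<open>D w\<close> to one real variable, where the mean value theorem and
  difference quotients are available.\<close>

lemma has_real_derivative_line:
  fixes g :: "'a::real_normed_vector \<Rightarrow> real"
  assumes "g differentiable at (q + s *\<^sub>R w)"
  shows "((\<lambda>s. g (q + s *\<^sub>R w)) has_real_derivative D w g (q + s *\<^sub>R w)) (at s)"
proof -
  have "((\<lambda>s. g (q + s *\<^sub>R w)) has_derivative (\<lambda>d. D (d *\<^sub>R w) g (q + s *\<^sub>R w))) (at s)"
    by (rule has_derivative_compose[where f = "\<lambda>s. q + s *\<^sub>R w", OF _ has_derivative_D[OF assms]])
       (auto intro!: derivative_eq_intros)
  moreover have "D (d *\<^sub>R w) g (q + s *\<^sub>R w) = D w g (q + s *\<^sub>R w) * d" for d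
    using linear_scale[OF linear_frechet_derivative[OF assms]] by simp
  ultimately show ?thesis by (simp add: has_field_derivative_def)
qed

text \<open>Both mixed derivatives are values of the same second difference quotient, by the mean value
  theorem applied twice.\<close>

lemma second_difference_mvt:
  fixes f :: "'a::real_normed_vector \<Rightarrow> real"
  assumes U: "ball p r \<subseteq> U" and f: "Ck_open 2 U f"
    and h: "h > 0" "h * (norm u + norm v) < r"
  shows "\<exists>q\<in>ball p r. f (p + h *\<^sub>R u + h *\<^sub>R v) - f (p + h *\<^sub>R u) - f (p + h *\<^sub>R v) + f p
           = h\<^sup>2 * D v (D u f) q"
proof -
  have in_ball: "p + s *\<^sub>R u + t *\<^sub>R v \<in> ball p r" if "0 \<le> s" "s \<le> h" "0 \<le> t" "t \<le> h" for s t
  proof -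
    have "norm (s *\<^sub>R u + t *\<^sub>R v) \<le> s * norm u + t * norm v"
      using that norm_triangle_ineq[of "s *\<^sub>R u" "t *\<^sub>R v"] by simp
    also have "\<dots> \<le> h * (norm u + norm v)"
      using that by (simp add: distrib_left add_mono mult_right_mono)
    finally have "norm (s *\<^sub>R u + t *\<^sub>R v) < r" using h by simp
    moreover have "dist p (p + s *\<^sub>R u + t *\<^sub>R v) = norm (s *\<^sub>R u + t *\<^sub>R v)"
      by (metis add.assoc add_diff_cancel_left' dist_commute dist_norm)
    ultimately show ?thesis by simp
  qed
  have f2: "Ck_open (Suc (Suc 0)) U f" using f by (simp add: numeral_2_eq_2)
  \<comment> \<open>The difference in direction \<open>v\<close>, followed along \<open>u\<close>;
    its increment over \<open>[0, h]\<close> is the second difference.\<close>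
  define \<phi> where "\<phi> s = f ((p + h *\<^sub>R v) + s *\<^sub>R u) - f (p + s *\<^sub>R u)" for s
  have "\<exists>s. 0 < s \<and> s < h \<and> \<phi> h - \<phi> 0 = (h - 0) * (D u f ((p + h *\<^sub>R v) + s *\<^sub>R u) - D u f (p + s *\<^sub>R u))"
  proof (rule MVT2[OF h(1)])
    fix s assume "0 \<le> s" "s \<le> h"
    then have "p + h *\<^sub>R v + s *\<^sub>R u \<in> U" "p + s *\<^sub>R u \<in> U"
      using in_ball[of s h] in_ball[of s 0] h U by (auto simp: algebra_simps)
    then show "(\<phi> has_real_derivative D u f ((p + h *\<^sub>R v) + s *\<^sub>R u) - D u f (p + s *\<^sub>R u)) (at s)"
      unfolding \<phi>_def using f2 by (intro DERIV_diff has_real_derivative_line) auto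
  qed
  then obtain s where s: "0 < s" "s < h"
    "\<phi> h - \<phi> 0 = h * (D u f ((p + h *\<^sub>R v) + s *\<^sub>R u) - D u f (p + s *\<^sub>R u))" by auto
  have "\<exists>t. 0 < t \<and> t < h \<and> D u f ((p + s *\<^sub>R u) + h *\<^sub>R v) - D u f ((p + s *\<^sub>R u) + 0 *\<^sub>R v)
      = (h - 0) * D v (D u f) ((p + s *\<^sub>R u) + t *\<^sub>R v)"
  proof (rule MVT2[OF h(1)])
    fix t assume "0 \<le> t" "t \<le> h"
    then have "p + s *\<^sub>R u + t *\<^sub>R v \<in> U" using in_ball[of s t] s U by auto
    moreover have "Ck_open (Suc 0) U (D u f)" using f2 by simp
    ultimately show "((\<lambda>t. D u f ((p + s *\<^sub>R u) + t *\<^sub>R v)) has_real_derivative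
        D v (D u f) ((p + s *\<^sub>R u) + t *\<^sub>R v)) (at t)"
      by (intro has_real_derivative_line) auto
  qed
  then obtain t where t: "0 < t" "t < h" "D u f ((p + s *\<^sub>R u) + h *\<^sub>R v) - D u f (p + s *\<^sub>R u)
      = h * D v (D u f) (p + s *\<^sub>R u + t *\<^sub>R v)" by auto
  have "p + s *\<^sub>R u + t *\<^sub>R v \<in> ball p r" using in_ball[of s t] s t by auto
  moreover have "f (p + h *\<^sub>R u + h *\<^sub>R v) - f (p + h *\<^sub>R u) - f (p + h *\<^sub>R v) + f p = \<phi> h - \<phi> 0"
    by (simp add: \<phi>_def algebra_simps)
  moreover have "\<phi> h - \<phi> 0 = h * (h * D v (D u f) (p + s *\<^sub>R u + t *\<^sub>R v))"
    using s(3) t(3) by (simp add: ac_simps)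
  ultimately show ?thesis by (metis mult.assoc power2_eq_square)
qed

text \<open>The second difference is symmetric in \<open>u\<close> and \<open>v\<close>, so in
  arbitrarily small balls the two derivatives take a common value, possibly at different points;
  continuity of both then excludes a gap at \<open>p\<close>.\<close>

lemma mixed_derivatives_commute:
  fixes f :: "'a::real_normed_vector \<Rightarrow> real"
  assumes U: "open U" "p \<in> U" and f: "Ck_open 2 U f"
  shows "D v (D u f) p = D u (D v f) p"
proof (rule ccontr)
  assume neq: "D v (D u f) p \<noteq> D u (D v f) p"
  \<comment> \<open>Half the gap: values closer than \<open>e\<close> to two numbers at distance
    \<open>2 * e\<close> cannot coincide.\<close>
  define e where "e = \<bar>D v (D u f) p - D u (D v f) p\<bar> / 2"
  have e: "e > 0" using neq by (simp add: e_def)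
  have cont: "continuous_on U (D a (D b f))" for a b
    using f by (simp add: numeral_2_eq_2)
  have near: "\<exists>r>0. ball p r \<subseteq> U \<and> (\<forall>q\<in>ball p r. \<bar>D a (D b f) q - D a (D b f) p\<bar> < e)" for a b
    by (rule continuous_on_open_near[OF U(1) cont U(2) e])
  obtain r1 r2 where r1: "r1 > 0" "ball p r1 \<subseteq> U" "\<And>q. q \<in> ball p r1 \<Longrightarrow> \<bar>D v (D u f) q - D v (D u f) p\<bar> < e"
    and r2: "r2 > 0" "\<And>q. q \<in> ball p r2 \<Longrightarrow> \<bar>D u (D v f) q - D u (D v f) p\<bar> < e"
    using near[of v u] near[of u v] by metis
  define r where "r = min r1 r2"
  have r: "r > 0" "ball p r \<subseteq> U" using r1 r2 by (auto simp: r_def)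
  \<comment> \<open>The summand 1 covers \<open>u = v = 0\<close> and makes the next bound
    strict.\<close>
  define h where "h = r / (norm u + norm v + 1)"
  have "h * (norm u + norm v) < r"
    using r(1) by (simp add: h_def pos_divide_less_eq add_nonneg_pos)
  moreover have h0: "h > 0" using r(1) by (simp add: h_def add_nonneg_pos)
  ultimately obtain q1 q2 where q: "q1 \<in> ball p r" "q2 \<in> ball p r"
    "f (p + h *\<^sub>R u + h *\<^sub>R v) - f (p + h *\<^sub>R u) - f (p + h *\<^sub>R v) + f p = h\<^sup>2 * D v (D u f) q1"
    "f (p + h *\<^sub>R v + h *\<^sub>R u) - f (p + h *\<^sub>R v) - f (p + h *\<^sub>R u) + f p = h\<^sup>2 * D u (D v f) q2"
    using second_difference_mvt[OF r(2) f, of h u v] second_difference_mvt[OF r(2) f, of h v u]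
    by (auto simp: add.commute)
  then have "h\<^sup>2 * D v (D u f) q1 = h\<^sup>2 * D u (D v f) q2" by (simp add: algebra_simps)
  then have "D v (D u f) q1 = D u (D v f) q2" using h0 by simp
  moreover have "\<bar>D v (D u f) q1 - D v (D u f) p\<bar> < e" "\<bar>D u (D v f) q2 - D u (D v f) p\<bar> < e"
    using r1(3)[of q1] r2(2)[of q2] q(1,2) by (simp_all add: r_def)
  ultimately show False unfolding e_def by argo
qed

section \<open>Further closure properties of the classes\<close>

lemma Ck_open_sub:
  assumes "open U" "Ck_open n U f" "Ck_open n U g"
  shows "Ck_open n U (\<lambda>p. f p - g p)"
  using Ck_open_add[OF assms(1,2) Ck_open_bounded_linear[OF bounded_linear_minus[OF bounded_linear_ident] assms(1,3)]]
  by simp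

lemma Ck_open_cmult:
  fixes f :: "'a::real_normed_vector \<Rightarrow> real"
  shows "open U \<Longrightarrow> Ck_open n U f \<Longrightarrow> Ck_open n U (\<lambda>p. c * f p)"
  by (rule Ck_open_mult[OF _ Ck_open_const])

text \<open>Later glues a product that is regular on one open set to the zero function on
  another.\<close>

lemma Ck_open_Un:
  assumes "open U" "open V"
  shows "Ck_open n U f \<Longrightarrow> Ck_open n V f \<Longrightarrow> Ck_open n (U \<union> V) f"
proof (induction n arbitrary: f)
  case 0
  then show ?case using assms by (simp add: continuous_on_open_Un)
next
  case (Suc n)
  have "Ck_open n (U \<union> V) (D v f)" for v
    by (rule Suc.IH) (use Suc.prems in simp_all)
  then show ?case using Suc.prems by auto
qed

section \<open>Bump functions and the fundamental lemma\<close>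

text \<open>The classical flat function exp(-1/t), together with its multiples by powers of 1/t:
  differentiation maps this family into its own linear span, so smoothness can be proved by
  induction.\<close>

definition exp_inv :: "nat \<Rightarrow> real \<Rightarrow> real" where
  "exp_inv m t = (if t > 0 then inverse t ^ m * exp (- inverse t) else 0)"

lemma exp_inv_tendsto_0: "(exp_inv m \<longlongrightarrow> 0) (at 0)"
proof (rule filterlim_split_at)
  show "(exp_inv m \<longlongrightarrow> 0) (at_left 0)"
    by (rule tendsto_eventually) (auto simp: eventually_at_filter exp_inv_def)
  have "((\<lambda>t. inverse t ^ m / exp (inverse t)) \<longlongrightarrow> (0::real)) (at_right 0)"
    by (rule filterlim_compose[OF tendsto_power_div_exp_0 filterlim_inverse_at_top_right])
  moreover have "\<forall>\<^sub>F t in at_right 0. inverse t ^ m / exp (inverse t) = exp_inv m t"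
    by (auto simp: eventually_at_filter exp_inv_def exp_minus divide_inverse)
  ultimately show "(exp_inv m \<longlongrightarrow> 0) (at_right 0)"
    by (rule Lim_transform_eventually)
qed

lemma exp_inv_has_derivative:
  "(exp_inv m has_real_derivative (exp_inv (m + 2) t - real m * exp_inv (m + 1) t)) (at t)"
proof (cases t "0::real" rule: linorder_cases)
  case less
  have "((\<lambda>_. 0) has_real_derivative 0) (at t)" by simp
  then have "(exp_inv m has_real_derivative 0) (at t)"
    by (rule has_field_derivative_transform_within_open[of _ _ _ "{..<0}"])
       (use less in \<open>auto simp: exp_inv_def\<close>)
  then show ?thesis using less by (simp add: exp_inv_def)
next
  case equal
  \<comment> \<open>The difference quotient at 0 is the next member of the family, whose limit is
    known. The claimed formula also gives 0 there, since every \<open>exp_inv\<close> vanishes at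
    0.\<close>
  have "\<forall>\<^sub>F h in at 0. exp_inv (m + 1) h = (exp_inv m (0 + h) - exp_inv m 0) / h"
    by (auto simp: eventually_at_filter exp_inv_def field_simps)
  from Lim_transform_eventually[OF exp_inv_tendsto_0 this]
  have "(exp_inv m has_real_derivative 0) (at 0)" by (simp add: DERIV_def)
  then show ?thesis using equal by (simp add: exp_inv_def)
next
  case greater
  have "((\<lambda>t. inverse t ^ m * exp (- inverse t)) has_real_derivative
     inverse t ^ (m + 2) * exp (- inverse t) - real m * (inverse t ^ (m + 1) * exp (- inverse t))) (at t)"
  proof -
    have "((\<lambda>t. exp (- inverse t)) has_real_derivative exp (- inverse t) * (inverse t)\<^sup>2) (at t)"
      using greater by (auto intro!: derivative_eq_intros simp: power2_eq_square)
    moreover have "((\<lambda>t. inverse t ^ m) has_real_derivative - (real m * inverse t ^ (m + 1))) (at t)"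
      using DERIV_power[OF DERIV_inverse[of t UNIV], of m] greater
      by (cases m) (auto simp: algebra_simps power2_eq_square)
    ultimately have "((\<lambda>t. inverse t ^ m * exp (- inverse t)) has_real_derivative
        - (real m * inverse t ^ (m + 1)) * exp (- inverse t) + exp (- inverse t) * (inverse t)\<^sup>2 * inverse t ^ m) (at t)"
      by (rule DERIV_mult[rotated])
    then show ?thesis by (simp add: power_add power2_eq_square algebra_simps)
  qed
  then have "(exp_inv m has_real_derivative
     inverse t ^ (m + 2) * exp (- inverse t) - real m * (inverse t ^ (m + 1) * exp (- inverse t))) (at t)"
    by (rule has_field_derivative_transform_within_open[of _ _ _ "{0<..}"])
       (use greater in \<open>auto simp: exp_inv_def\<close>)
  then show ?thesis using greater by (simp add: exp_inv_def)
qed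

text \<open>Differentiation raises \<open>m\<close> by one and two, so the induction on the order
  runs over all \<open>m\<close> at once.\<close>

lemma Ck_open_exp_inv:
  fixes h :: "'a::real_normed_vector \<Rightarrow> real"
  assumes "\<And>n. Ck_open n UNIV h"
  shows "Ck_open n UNIV (\<lambda>p. exp_inv m (h p))"
proof (induction n arbitrary: m)
  case 0
  have "continuous_on UNIV (exp_inv m)"
    by (rule continuous_at_imp_continuous_on) (auto intro: DERIV_isCont exp_inv_has_derivative)
  then show ?case using continuous_on_compose2[of UNIV "exp_inv m" UNIV h] assms[of 0] by auto
next
  case (Suc n)
  let ?d = "\<lambda>p. exp_inv (m + 2) (h p) - real m * exp_inv (m + 1) (h p)"
  show ?case
  proof (rule Ck_open_SucI[where f' = "\<lambda>v p. D v h p * ?d p"])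
    fix p :: 'a
    have "h differentiable at p" using assms[of 1] by simp
    then show "((\<lambda>p. exp_inv m (h p)) has_derivative (\<lambda>v. D v h p * ?d p)) (at p)"
      by (rule DERIV_compose_FDERIV[OF exp_inv_has_derivative has_derivative_D])
    show "Ck_open n UNIV (\<lambda>p. D v h p * ?d p)" for v
      using assms[of "Suc n"] by (intro Ck_open_mult Ck_open_sub Ck_open_cmult Suc.IH) auto
  qed simp
qed

text \<open>A quadratic polynomial: its derivative is affine and the next one constant, which ends
  the descent.\<close>

lemma Ck_open_power2_dist:
  fixes a :: "'a::real_inner"
  shows "Ck_open n UNIV (\<lambda>p. c - (p - a) \<bullet> (p - a))"
proof -
  have lin: "Ck_open n UNIV (\<lambda>p. -2 * ((p - a) \<bullet> v))" for n v
  proof (cases n)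
    case 0
    then show ?thesis by (auto intro!: continuous_intros)
  next
    case (Suc k)
    show ?thesis unfolding Suc
      by (rule Ck_open_SucI[where f' = "\<lambda>u p. -2 * (u \<bullet> v)"])
         (auto intro!: derivative_eq_intros Ck_open_const)
  qed
  show ?thesis
  proof (cases n)
    case 0
    then show ?thesis by (auto intro!: continuous_intros)
  next
    case (Suc k)
    show ?thesis unfolding Suc
      by (rule Ck_open_SucI[where f' = "\<lambda>v p. -2 * ((p - a) \<bullet> v)", OF _ _ lin])
         (auto intro!: derivative_eq_intros simp: inner_commute)
  qed
qed

text \<open>Composes \<open>exp_inv 0\<close> with r^2 - |p - a|^2, which is positive exactly inside
  the ball. The support is the closed ball, whence the hypothesis on \<open>cball\<close>.\<close>

lemma bump_exists:
  fixes a :: "'a::euclidean_space"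
  assumes "r > 0" "cball a r \<subseteq> V"
  shows "\<exists>\<phi>::'a \<Rightarrow> real. test_function V \<phi> \<and> (\<forall>p. \<phi> p \<ge> 0) \<and> (\<forall>p. \<phi> p > 0 \<longleftrightarrow> p \<in> ball a r)"
proof -
  define \<phi> where "\<phi> p = exp_inv 0 (r\<^sup>2 - (p - a) \<bullet> (p - a))" for p
  have in_ball: "0 < r\<^sup>2 - (p - a) \<bullet> (p - a) \<longleftrightarrow> p \<in> ball a r" for p
  proof -
    have "(p - a) \<bullet> (p - a) = (dist a p)\<^sup>2"
      by (simp add: dist_norm power2_norm_eq_inner inner_diff inner_commute)
    moreover have "(dist a p)\<^sup>2 < r\<^sup>2 \<longleftrightarrow> dist a p < r"
      using assms(1) by (simp add: power_mono_iff flip: not_le)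
    ultimately show ?thesis by simp
  qed
  have pos: "\<phi> p > 0 \<longleftrightarrow> p \<in> ball a r" for p
    unfolding \<phi>_def exp_inv_def in_ball by simp
  have nonneg: "\<phi> p \<ge> 0" for p unfolding \<phi>_def exp_inv_def by simp
  then have "{p. \<phi> p \<noteq> 0} = ball a r" using pos by (metis (mono_tags) Collect_cong Collect_mem_eq less_le)
  moreover have "\<forall>n. Ck_open n UNIV \<phi>"
    unfolding \<phi>_def by (intro allI Ck_open_exp_inv Ck_open_power2_dist)
  ultimately have "test_function V \<phi>"
    using assms by (simp add: test_function_def)
  then show ?thesis using pos nonneg by blast
qed

section \<open>The fundamental lemma of the calculus of variations\<close>

lemma integrable_compact_support:
  fixes f :: "'a::euclidean_space \<Rightarrow> real"
  assumes "compact K" "continuous_on K f" "\<And>p. p \<notin> K \<Longrightarrow> f p = 0"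
  shows "integrable lborel f"
proof -
  have "(\<lambda>p. indicator K p *\<^sub>R f p) = f" using assms(3) by (auto simp: indicator_def fun_eq_iff)
  then show ?thesis using borel_integrable_compact[OF assms(1,2)] by simp
qed

text \<open>If \<open>u a > 0\<close>, then \<open>u\<close> is positive near \<open>a\<close>;
  against a bump there the integrand is nonnegative with integral zero, hence zero almost
  everywhere, although it is positive on a ball. The one-sided form is later applied to
  \<open>- u\<close> as well.\<close>

lemma fundamental_lemma_pos:
  fixes u :: "'a::euclidean_space \<Rightarrow> real"
  assumes V: "open V" and u: "continuous_on V u"
    and int: "\<And>\<phi>. test_function V \<phi> \<Longrightarrow> (LINT p|lborel. u p * \<phi> p) = 0"
    and a: "a \<in> V"
  shows "u a \<le> 0"
proof (rule ccontr)
  assume "\<not> u a \<le> 0"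
  then obtain r where r: "r > 0" "ball a r \<subseteq> V" "\<And>q. q \<in> ball a r \<Longrightarrow> \<bar>u q - u a\<bar> < u a"
    using continuous_on_open_near[OF V u a, of "u a"] by auto
  \<comment> \<open>Halving the radius puts the closed ball, which is the support of the bump,
    inside the open ball where \<open>u\<close> is positive.\<close>
  have sub: "cball a (r/2) \<subseteq> ball a r" using r(1) by auto
  then have sub_V: "cball a (r/2) \<subseteq> V" using r(2) by blast
  have upos: "u q > 0" if "q \<in> cball a (r/2)" for q
    using r(3)[of q] that sub by fastforce
  have "r/2 > 0" using r(1) by simp
  obtain \<phi> :: "'a \<Rightarrow> real" where \<phi>: "test_function V \<phi>" "\<And>p. \<phi> p \<ge> 0" "\<And>p. \<phi> p > 0 \<longleftrightarrow> p \<in> ball a (r/2)"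
    using bump_exists[OF \<open>r/2 > 0\<close> sub_V] by blast
  have zero: "\<phi> p = 0" if "p \<notin> ball a (r/2)" for p
    using \<phi>(2)[of p] \<phi>(3)[of p] that by linarith
  have "continuous_on UNIV \<phi>" using \<phi>(1) by (auto simp: test_function_def dest: spec[of _ 0])
  then have "continuous_on (cball a (r/2)) (\<lambda>p. u p * \<phi> p)"
    by (intro continuous_on_mult continuous_on_subset[OF u sub_V]) (auto elim: continuous_on_subset)
  then have "integrable lborel (\<lambda>p. u p * \<phi> p)"
    by (rule integrable_compact_support[rotated]) (auto simp: zero)
  moreover have "u p * \<phi> p \<ge> 0" for p
    using upos[of p] zero[of p] \<phi>(2)[of p] by (cases "p \<in> ball a (r/2)") (auto simp: less_imp_le)
  ultimately have "AE p in lborel. u p * \<phi> p = 0"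
    using int[OF \<phi>(1)] integral_nonneg_eq_0_iff_AE by blast
  moreover have "u p * \<phi> p \<noteq> 0" if "p \<in> ball a (r/2)" for p
    using upos[of p] \<phi>(3)[of p] that by auto
  ultimately have "AE p in lborel. p \<in> ball a (r/2) \<longrightarrow> p \<in> {}"
    by (auto elim!: eventually_mono)
  \<comment> \<open>A closed set containing almost every point of an open set contains all of it;
    applied to the empty set, this says that the ball is not null.\<close>
  then have "AE p \<in> ball a (r/2) in lebesgue. p \<in> {}"
    by (rule AE_completion)
  then have "a \<in> {}"
    by (rule mem_closed_if_AE_lebesgue_open[rotated 2]) (use r(1) in auto)
  then show False by simp
qed

lemma fundamental_lemma:
  fixes u :: "'a::euclidean_space \<Rightarrow> real"
  assumes "open V" "continuous_on V u"
    and "\<And>\<phi>. test_function V \<phi> \<Longrightarrow> (LINT p|lborel. u p * \<phi> p) = 0"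
    and "a \<in> V"
  shows "u a = 0"
proof -
  have "- u a \<le> 0"
    by (rule fundamental_lemma_pos[OF assms(1) _ _ assms(4)])
       (use assms in \<open>auto intro: continuous_on_minus\<close>)
  with fundamental_lemma_pos[OF assms] show ?thesis by linarith
qed

text \<open>The complement of a closed set is an open neighbourhood of \<open>p\<close>, on which
  \<open>f\<close> agrees with the zero function.\<close>

lemma D_eq_0_outside:
  assumes "closed K" "\<And>p. p \<notin> K \<Longrightarrow> f p = 0" "p \<notin> K"
  shows "D v f p = 0"
proof -
  have "D v f p = D v (\<lambda>_. 0) p"
    by (rule D_cong[symmetric, of "- K"]) (use assms in auto)
  then show ?thesis by simp
qed

section \<open>Integration by parts\<close>

lemma integral_translate:
  fixes g :: "'a::euclidean_space \<Rightarrow> real"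
  assumes "g \<in> borel_measurable borel"
  shows "(LINT p|lborel. g (p + v)) = (LINT p|lborel. g p)"
proof -
  have "(LINT p|lborel. g p) = (LINT p|distr lborel borel ((+) v). g p)"
    by (simp add: lborel_distr_plus)
  also have "\<dots> = (LINT p|lborel. g (v + p))"
    by (rule integral_distr) (use assms in auto)
  finally show ?thesis by (simp add: add.commute)
qed

text \<open>Each difference quotient of \<open>g\<close> along \<open>v\<close> has integral zero by
  translation invariance; the quotients converge pointwise to the derivative, and dominated
  convergence passes to the limit.\<close>

lemma integral_D_eq_0:
  fixes g :: "'a::euclidean_space \<Rightarrow> real"
  assumes g: "Ck_open 1 UNIV g" and K: "compact K" "\<And>p. p \<notin> K \<Longrightarrow> g p = 0"
  shows "(LINT p|lborel. D v g p) = 0"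
proof -
  have diff: "g differentiable at p" for p using g by simp
  have cont_D: "continuous_on UNIV (D v g)" using g by simp
  have cont: "continuous_on UNIV g" by (rule Ck_open_continuous[OF g])
  have D0: "D v g p = 0" if "p \<notin> K" for p
    using D_eq_0_outside[OF compact_imp_closed[OF K(1)] K(2) that] .
  obtain B where B: "B \<ge> 0" "\<And>p. \<bar>D v g p\<bar> \<le> B"
  proof -
    have "compact (D v g ` K)"
      by (rule compact_continuous_image[OF continuous_on_subset[OF cont_D] K(1)]) simp
    then obtain B where "B > 0" "\<And>p. p \<in> K \<Longrightarrow> \<bar>D v g p\<bar> \<le> B"
      by (auto dest!: compact_imp_bounded simp: bounded_pos)
    then have "\<bar>D v g p\<bar> \<le> B" for p using D0[of p] by (cases "p \<in> K") auto
    with \<open>B > 0\<close> show ?thesis using that[of B] by simp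
  qed
  \<comment> \<open>\<open>K\<close> swept backwards along \<open>v\<close> for times in
    \<open>[0, 1]\<close>. Since \<open>h n <= 1\<close>, it contains the support of every quotient
    \<open>s n\<close>, so \<open>B\<close> times its indicator dominates them all.\<close>
  define K' where "K' = (\<lambda>(p, t). p - t *\<^sub>R v) ` (K \<times> {0..1::real})"
  have K': "compact K'"
    unfolding K'_def
    by (intro compact_continuous_image compact_Times K(1) compact_Icc)
       (auto intro!: continuous_intros simp: case_prod_beta)
  define h where "h n = 1 / real (Suc n)" for n
  have h: "0 < h n" "h n \<le> 1" for n by (auto simp: h_def)
  define s where "s n p = (g (p + h n *\<^sub>R v) - g p) / h n" for n p
  have g_int: "integrable lborel g"
    by (rule integrable_compact_support[OF K(1) continuous_on_subset[OF cont] K(2)]) simp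
  have g_meas: "g \<in> borel_measurable borel" using cont by (rule borel_measurable_continuous_onI)
  have bound: "norm (s n p) \<le> B * indicator K' p" for n p
  proof (cases "p \<in> K'")
    case True
    \<comment> \<open>By the mean value theorem the quotient is a value of the derivative, hence
      bounded by \<open>B\<close>.\<close>
    have "\<exists>z. 0 < z \<and> z < h n \<and> g (p + h n *\<^sub>R v) - g (p + 0 *\<^sub>R v) = (h n - 0) * D v g (p + z *\<^sub>R v)"
      by (rule MVT2[OF h(1)]) (rule has_real_derivative_line[OF diff])
    then obtain z where "g (p + h n *\<^sub>R v) - g p = h n * D v g (p + z *\<^sub>R v)" by auto
    then have "s n p = D v g (p + z *\<^sub>R v)" using h(1)[of n] by (simp add: s_def)
    then show ?thesis using True B by simp
  next
    case False
    have "p + t *\<^sub>R v \<notin> K" if "0 \<le> t" "t \<le> 1" for t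
      using False that by (force simp: K'_def image_iff)
    from this[of 0] this[of "h n"] have "g p = 0" "g (p + h n *\<^sub>R v) = 0"
      using h[of n] K(2) by (auto simp: less_imp_le)
    then show ?thesis using B by (simp add: s_def)
  qed
  have "(\<lambda>n. LINT p|lborel. s n p) \<longlonglongrightarrow> (LINT p|lborel. D v g p)"
  proof (rule integral_dominated_convergence[where w = "\<lambda>p. B * indicator K' p"])
    show "D v g \<in> borel_measurable lborel"
      using borel_measurable_continuous_onI[OF cont_D] by simp
    show "s n \<in> borel_measurable lborel" for n
      unfolding s_def using g_meas by measurable
    show "integrable lborel (\<lambda>p. B * indicator K' p)"
      using K' by (auto intro!: integrable_real_indicator emeasure_bounded_finite compact_imp_bounded
          borel_compact)
    show "AE p in lborel. (\<lambda>n. s n p) \<longlonglongrightarrow> D v g p"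
    proof (rule AE_I2)
      fix p
      have "((\<lambda>t. (g (p + t *\<^sub>R v) - g p) / t) \<longlongrightarrow> D v g p) (at 0)"
        using has_real_derivative_line[of g p 0 v] diff by (simp add: DERIV_def)
      moreover have "filterlim h (at 0) sequentially"
        unfolding filterlim_at h_def using LIMSEQ_inverse_real_of_nat
        by (simp add: inverse_eq_divide)
      ultimately show "(\<lambda>n. s n p) \<longlonglongrightarrow> D v g p"
        unfolding s_def by (rule filterlim_compose)
    qed
  qed (use bound in auto)
  moreover have "(LINT p|lborel. s n p) = 0" for n
  proof -
    have "integrable lborel (\<lambda>p. g (p + h n *\<^sub>R v))"
    proof (rule integrable_compact_support)
      show "compact ((\<lambda>p. p - h n *\<^sub>R v) ` K)"
        by (rule compact_continuous_image[OF _ K(1)]) (auto intro!: continuous_intros)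
      show "continuous_on ((\<lambda>p. p - h n *\<^sub>R v) ` K) (\<lambda>p. g (p + h n *\<^sub>R v))"
        by (rule continuous_on_compose2[OF cont]) (auto intro!: continuous_intros)
      show "g (p + h n *\<^sub>R v) = 0" if "p \<notin> (\<lambda>p. p - h n *\<^sub>R v) ` K" for p
        using that K(2) by (force simp: image_iff)
    qed
    then show ?thesis
      unfolding s_def using g_int integral_translate[OF g_meas, of "h n *\<^sub>R v"] by simp
  qed
  ultimately show ?thesis by (simp add: LIMSEQ_const_iff)
qed

lemma test_functionD:
  assumes "test_function V \<phi>"
  obtains K where "compact K" "K \<subseteq> V" "\<And>p. p \<notin> K \<Longrightarrow> \<phi> p = 0" "\<And>n. Ck_open n UNIV \<phi>"
proof (rule that[of "closure {p. \<phi> p \<noteq> 0}"])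
  show "\<phi> p = 0" if "p \<notin> closure {p. \<phi> p \<noteq> 0}" for p
    using that closure_subset[of "{p. \<phi> p \<noteq> 0}"] by blast
qed (use assms in \<open>simp_all add: test_function_def\<close>)

text \<open>Apply \<open>integral_D_eq_0\<close> to the product. As \<open>w\<close> is uncontrolled
  outside \<open>V\<close>, its regularity on the whole space comes from gluing: the product rule on
  \<open>V\<close>, the zero function off the support \<open>K\<close>.\<close>

lemma integral_by_parts:
  fixes w \<phi> :: "'a::euclidean_space \<Rightarrow> real"
  assumes V: "open V" and w: "Ck_open 1 V w" and \<phi>: "test_function V \<phi>"
  shows "integrable lborel (\<lambda>p. w p * D v \<phi> p)" "integrable lborel (\<lambda>p. D v w p * \<phi> p)"
    "(LINT p|lborel. w p * D v \<phi> p) = - (LINT p|lborel. D v w p * \<phi> p)"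
proof -
  obtain K where K: "compact K" "K \<subseteq> V" "\<And>p. p \<notin> K \<Longrightarrow> \<phi> p = 0" and smooth: "\<And>n. Ck_open n UNIV \<phi>"
    using test_functionD[OF \<phi>] by blast
  have cK: "closed K" using K(1) compact_imp_closed by blast
  have D0: "D v \<phi> p = 0" if "p \<notin> K" for p
    using D_eq_0_outside[OF cK K(3) that] .
  have \<phi>1: "Ck_open 1 UNIV \<phi>" by (rule smooth)
  have cont: "continuous_on K w" "continuous_on K \<phi>" "continuous_on K (D v w)" "continuous_on K (D v \<phi>)"
    using continuous_on_subset[OF Ck_open_continuous[OF w] K(2)]
      continuous_on_subset[OF Ck_open_continuous[OF \<phi>1]] w \<phi>1 K(2)
    by (auto intro: continuous_on_subset)
  show I1: "integrable lborel (\<lambda>p. w p * D v \<phi> p)"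
    using cont D0 by (intro integrable_compact_support[OF K(1)] continuous_on_mult) auto
  show I2: "integrable lborel (\<lambda>p. D v w p * \<phi> p)"
    using cont K(3) by (intro integrable_compact_support[OF K(1)] continuous_on_mult) auto
  have "Ck_open 1 V (\<lambda>p. w p * \<phi> p)"
    using Ck_open_mult[OF V w Ck_open_subset[OF \<phi>1]] by simp
  moreover have "Ck_open 1 (- K) (\<lambda>p. w p * \<phi> p)"
    by (rule Ck_open_cong[OF _ _ Ck_open_const[of _ _ 0]]) (use cK K(3) in auto)
  ultimately have "Ck_open 1 (V \<union> - K) (\<lambda>p. w p * \<phi> p)"
    using V cK by (intro Ck_open_Un) auto
  then have "Ck_open 1 UNIV (\<lambda>p. w p * \<phi> p)"
    by (rule Ck_open_subset) (use K(2) in auto)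
  then have "(LINT p|lborel. D v (\<lambda>p. w p * \<phi> p) p) = 0"
    by (rule integral_D_eq_0[OF _ K(1)]) (simp add: K(3))
  moreover have "D v (\<lambda>p. w p * \<phi> p) p = w p * D v \<phi> p + D v w p * \<phi> p" for p
  proof (cases "p \<in> K")
    case True
    then have d: "w differentiable at p" "\<phi> differentiable at p" using K(2) w \<phi>1 by auto
    show ?thesis
      using D_eqI[OF has_derivative_mult[OF has_derivative_D[OF d(1)] has_derivative_D[OF d(2)]]] .
  next
    case False
    then show ?thesis
      using D_eq_0_outside[OF cK _ False, of "\<lambda>p. w p * \<phi> p" v] D0[OF False] K(3) by simp
  qed
  ultimately have "(LINT p|lborel. w p * D v \<phi> p + D v w p * \<phi> p) = 0" by simp
  then show "(LINT p|lborel. w p * D v \<phi> p) = - (LINT p|lborel. D v w p * \<phi> p)"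
    using I1 I2 by simp
qed

text \<open>Directions are indexed by a set \<open>I\<close>, so that one time direction and three
  space directions form a single divergence.\<close>

lemma weak_divergence_eq_0:
  fixes w :: "'i \<Rightarrow> 'a::euclidean_space \<Rightarrow> real"
  assumes V: "open V" and w: "\<And>i. i \<in> I \<Longrightarrow> Ck_open 1 V (w i)"
    and weak: "\<And>\<phi>. test_function V \<phi> \<Longrightarrow> (LINT p|lborel. (\<Sum>i\<in>I. w i p * D (v i) \<phi> p)) = 0"
    and p: "p \<in> V"
  shows "(\<Sum>i\<in>I. D (v i) (w i) p) = 0"
proof (rule fundamental_lemma[OF V _ _ p])
  have "continuous_on V (D (v i) (w i))" if "i \<in> I" for i
    using w[OF that] by simp
  then show "continuous_on V (\<lambda>p. \<Sum>i\<in>I. D (v i) (w i) p)"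
    by (rule continuous_on_sum)
  fix \<phi> :: "'a \<Rightarrow> real" assume \<phi>: "test_function V \<phi>"
  have "(LINT p|lborel. (\<Sum>i\<in>I. D (v i) (w i) p) * \<phi> p)
      = (\<Sum>i\<in>I. LINT p|lborel. D (v i) (w i) p * \<phi> p)"
    unfolding sum_distrib_right
    by (rule Bochner_Integration.integral_sum) (rule integral_by_parts(2)[OF V w \<phi>])
  also have "\<dots> = - (\<Sum>i\<in>I. LINT p|lborel. w i p * D (v i) \<phi> p)"
    unfolding sum_negf[symmetric]
    by (rule sum.cong) (simp_all add: integral_by_parts(3)[OF V w \<phi>])
  also have "\<dots> = - (LINT p|lborel. (\<Sum>i\<in>I. w i p * D (v i) \<phi> p))"
    by (subst Bochner_Integration.integral_sum) (auto intro: integral_by_parts(1)[OF V w \<phi>])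
  finally show "(LINT p|lborel. (\<Sum>i\<in>I. D (v i) (w i) p) * \<phi> p) = 0"
    using weak[OF \<phi>] by simp
qed

section \<open>Space-time derivatives\<close>

abbreviation Dt :: "((real^3) \<times> real \<Rightarrow> 'b::real_normed_vector) \<Rightarrow> (real^3) \<times> real \<Rightarrow> 'b" where
  "Dt \<equiv> D (0, 1)"

abbreviation Dx :: "3 \<Rightarrow> ((real^3) \<times> real \<Rightarrow> 'b::real_normed_vector) \<Rightarrow> (real^3) \<times> real \<Rightarrow> 'b" where
  "Dx i \<equiv> D (axis i 1, 0)"

text \<open>The chain rule along a curve, bridging the one-variable derivatives in \<open>dt\<close>
  and \<open>partial\<close> to the Frechet derivative. Agreement of \<open>g\<close> with
  \<open>f\<close> is asked only while the curve stays in \<open>U\<close>.\<close>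

lemma has_vector_derivative_curve:
  assumes "open U" "\<gamma> s \<in> U" "continuous_on UNIV \<gamma>" "(\<gamma> has_vector_derivative v) (at s)"
    and "f differentiable at (\<gamma> s)" "\<And>s'. \<gamma> s' \<in> U \<Longrightarrow> g s' = f (\<gamma> s')"
  shows "(g has_vector_derivative D v f (\<gamma> s)) (at s)"
proof -
  have op: "open (\<gamma> -` U)" using assms(1,3) by (rule open_vimage)
  have "((f \<circ> \<gamma>) has_vector_derivative D v f (\<gamma> s)) (at s)"
    using vector_derivative_diff_chain_within[OF assms(4), of f "\<lambda>v. D v f (\<gamma> s)"]
      has_derivative_at_withinI[OF has_derivative_D[OF assms(5)]] by blast
  from has_vector_derivative_transform_within_open[OF this op] show ?thesis
    using assms(2,6) by simp
qed

lemma dt_eq_Dt: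
  assumes "open U" "(x, t) \<in> U" "f differentiable at (x, t)" "\<And>y s. (y, s) \<in> U \<Longrightarrow> F y s = f (y, s)"
  shows "dt F x t = Dt f (x, t)"
  unfolding dt_def
  by (rule vector_derivative_at, rule has_vector_derivative_curve[of U "\<lambda>s. (x, s)"])
     (use assms in \<open>auto intro!: continuous_intros derivative_eq_intros
        simp: has_vector_derivative_def zero_prod_def\<close>)

lemma partial_eq_Dx:
  assumes "open U" "(x, t) \<in> U" "f differentiable at (x, t)" "\<And>y. (y, t) \<in> U \<Longrightarrow> F y = f (y, t)"
  shows "partial i F x = Dx i f (x, t)"
proof -
  have "((\<lambda>h. F (x + h *\<^sub>R axis i 1)) has_vector_derivative Dx i f (x + 0 *\<^sub>R axis i 1, t)) (at 0)"
    by (rule has_vector_derivative_curve[of U "\<lambda>h. (x + h *\<^sub>R axis i 1, t)"])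
       (use assms in \<open>auto intro!: continuous_intros derivative_eq_intros
        simp: has_vector_derivative_def\<close>)
  then show ?thesis unfolding partial_def by (simp add: vector_derivative_at)
qed

text \<open>The spatial curl of a time-dependent field given by its three scalar components.\<close>

definition curlD :: "(3 \<Rightarrow> (real^3) \<times> real \<Rightarrow> real) \<Rightarrow> (real^3) \<times> real \<Rightarrow> real^3" where
  "curlD f p = vector [Dx 2 (f 3) p - Dx 3 (f 2) p, Dx 3 (f 1) p - Dx 1 (f 3) p, Dx 1 (f 2) p - Dx 2 (f 1) p]"

lemma dt_vec_eq_Dt:
  fixes F :: "real^3 \<Rightarrow> real \<Rightarrow> real^3"
  assumes "open U" "(x, t) \<in> U" "\<And>j. f j differentiable at (x, t)"
    "\<And>j y s. (y, s) \<in> U \<Longrightarrow> F y s $ j = f j (y, s)"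
  shows "dt F x t = (\<chi> j. Dt (f j) (x, t))"
proof -
  have comp: "((\<lambda>s. F x s $ j) has_vector_derivative Dt (f j) (x, t)) (at t)" for j
    by (rule has_vector_derivative_curve[of U "\<lambda>s. (x, s)"])
     (use assms in \<open>auto intro!: continuous_intros derivative_eq_intros
        simp: has_vector_derivative_def zero_prod_def\<close>)
  have "(F x has_vector_derivative (\<chi> j. Dt (f j) (x, t))) (at t)"
    unfolding has_vector_derivative_def
    by (subst has_derivative_componentwise_within)
       (use comp in \<open>auto simp: has_vector_derivative_def Basis_vec_def inner_axis\<close>)
  then show ?thesis unfolding dt_def by (rule vector_derivative_at)
qed

lemma grad_eq_Dx:
  assumes "open U" "(x, t) \<in> U" "f differentiable at (x, t)" "\<And>y. (y, t) \<in> U \<Longrightarrow> F y = f (y, t)"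
  shows "grad F x = (\<chi> i. Dx i f (x, t))"
  unfolding grad_def by (simp add: partial_eq_Dx[OF assms])

lemma div3_eq_Dx:
  assumes "open U" "(x, t) \<in> U" "\<And>j. f j differentiable at (x, t)"
    "\<And>j y. (y, t) \<in> U \<Longrightarrow> F y $ j = f j (y, t)"
  shows "div3 F x = (\<Sum>i\<in>UNIV. Dx i (f i) (x, t))"
  unfolding div3_def
  by (intro sum.cong refl partial_eq_Dx[OF assms(1,2)]) (use assms in auto)

lemma curl_eq_curlD:
  assumes "open U" "(x, t) \<in> U" "\<And>j. f j differentiable at (x, t)"
    "\<And>j y. (y, t) \<in> U \<Longrightarrow> F y $ j = f j (y, t)"
  shows "curl F x = curlD f (x, t)"
proof -
  have "partial i (\<lambda>y. F y $ j) x = Dx i (f j) (x, t)" for i j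
    by (rule partial_eq_Dx[OF assms(1,2)]) (use assms in auto)
  then show ?thesis unfolding curl_def curlD_def by simp
qed

lemma D_add:
  "f differentiable at p \<Longrightarrow> g differentiable at p \<Longrightarrow> D v (\<lambda>p. f p + g p) p = D v f p + D v g p"
  by (rule D_eqI, rule has_derivative_add; rule has_derivative_D)

lemma D_diff:
  "f differentiable at p \<Longrightarrow> g differentiable at p \<Longrightarrow> D v (\<lambda>p. f p - g p) p = D v f p - D v g p"
  by (rule D_eqI, rule has_derivative_diff; rule has_derivative_D)

lemma D_cmult:
  fixes f :: "'a::real_normed_vector \<Rightarrow> real"
  shows "f differentiable at p \<Longrightarrow> D v (\<lambda>p. c * f p) p = c * D v f p"
  by (rule D_eqI, rule has_derivative_mult_right, rule has_derivative_D)

lemma D_sum: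
  "(\<And>i. i \<in> I \<Longrightarrow> f i differentiable at p) \<Longrightarrow> D v (\<lambda>p. \<Sum>i\<in>I. f i p) p = (\<Sum>i\<in>I. D v (f i) p)"
  by (rule D_eqI, rule has_derivative_sum, rule has_derivative_D)

lemma curlD_perturb:
  assumes "\<And>j. a j differentiable at p" "\<phi> differentiable at p"
  shows "curlD (\<lambda>j p. a j p + e * c $ j * \<phi> p) p = curlD a p + e *\<^sub>R cross3 (\<chi> i. Dx i \<phi> p) c"
proof -
  have "Dx i (\<lambda>p. a j p + e * c $ j * \<phi> p) p = Dx i (a j) p + e * c $ j * Dx i \<phi> p" for i j
    using assms by (simp add: D_add D_cmult)
  then show ?thesis
    by (simp add: curlD_def cross3_def vec_eq_iff forall_3 algebra_simps)
qed

lemma continuous_on_curlD: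
  assumes "\<And>i j. continuous_on S (Dx i (f j))"
  shows "continuous_on S (curlD f)"
proof -
  have "continuous_on S (\<lambda>p. curlD f p $ j)" for j
    using exhaust_3[of j] by (auto simp: curlD_def intro!: continuous_on_diff assms)
  from continuous_on_vec_lambda[of S "\<lambda>j p. curlD f p $ j", OF this] show ?thesis by simp
qed

text \<open>Fubini, with time as the outer variable; joint integrability must be known beforehand,
  as the iterated integral alone does not reveal it.\<close>

lemma action_eq_integral:
  assumes "set_integrable lborel (\<Omega> \<times> {t0..t1}) (\<lambda>(x, t). Lagrangian c0 ch Z A x t)"
  shows "action c0 ch \<Omega> t0 t1 Z A
    = (LINT p|lborel. indicator (\<Omega> \<times> {t0..t1}) p * (\<lambda>(x, t). Lagrangian c0 ch Z A x t) p)"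
proof -
  interpret lborel_pair: pair_sigma_finite "lborel :: (real^3) measure" "lborel :: real measure" ..
  let ?f = "\<lambda>x t. indicator (\<Omega> \<times> {t0..t1}) (x, t) * Lagrangian c0 ch Z A x t"
  have f: "case_prod ?f = (\<lambda>p. indicator (\<Omega> \<times> {t0..t1}) p * (\<lambda>(x, t). Lagrangian c0 ch Z A x t) p)"
    by auto
  have "integrable (lborel \<Otimes>\<^sub>M lborel) (case_prod ?f)"
    using assms unfolding f lborel_prod set_integrable_def by simp
  from lborel_pair.integral_snd[OF this]
  have "(LINT t|lborel. LINT x|lborel. ?f x t) = (LINT p|lborel. case_prod ?f p)"
    by (simp add: lborel_prod)
  moreover have "(LINT x|lborel. ?f x t)
      = indicator {t0..t1} t *\<^sub>R (LINT x|lborel. indicator \<Omega> x *\<^sub>R Lagrangian c0 ch Z A x t)" for t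
    by (simp add: indicator_times mult.assoc mult.left_commute[of _ "indicator {t0..t1} t"]
        flip: integral_mult_right_zero)
  ultimately show ?thesis
    unfolding action_def set_lebesgue_integral_def f by simp
qed

section \<open>The first variation\<close>

text \<open>A linear map can only shrink the support. Provides the variations \<open>b * phi\<close>
  and \<open>phi *\<^sub>R c\<close> from one scalar bump.\<close>

lemma test_function_linear:
  assumes "test_function V \<phi>" "bounded_linear L"
  shows "test_function V (\<lambda>p. L (\<phi> p))"
proof -
  have "{p. L (\<phi> p) \<noteq> 0} \<subseteq> {p. \<phi> p \<noteq> 0}"
    using linear_0[OF bounded_linear.linear[OF assms(2)]] by auto
  then have sub: "closure {p. L (\<phi> p) \<noteq> 0} \<subseteq> closure {p. \<phi> p \<noteq> 0}" by (rule closure_mono)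
  moreover have "compact (closure {p. L (\<phi> p) \<noteq> 0})"
    using compact_Int_closed[of "closure {p. \<phi> p \<noteq> 0}" "closure {p. L (\<phi> p) \<noteq> 0}"] assms(1) sub
    by (simp add: test_function_def Int_absorb1)
  ultimately show ?thesis
    using assms Ck_open_bounded_linear[OF assms(2) open_UNIV, of _ \<phi>]
    unfolding test_function_def by blast
qed

lemma Ck_open_1_continuous_D: "Ck_open 1 U f \<Longrightarrow> continuous_on U (D v f)"
  by simp

lemma quadratic_derivative_0:
  fixes f :: "real \<Rightarrow> real"
  assumes "\<And>e. f e = k0 + e * k1 + e\<^sup>2 * k2" "(f has_real_derivative 0) (at 0)"
  shows "k1 = 0"
proof -
  have "((\<lambda>e. k0 + e * k1 + e\<^sup>2 * k2) has_real_derivative k1) (at 0)"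
    by (auto intro!: derivative_eq_intros)
  then have "(f has_real_derivative k1) (at 0)" unfolding assms(1) .
  then show ?thesis using assms(2) DERIV_unique by blast
qed

text \<open>All differential operators are linear, so every squared term is the square of an affine
  function of \<open>e\<close>. Here \<open>G\<close> is the gradient of the bump, and
  \<open>N\<close> is the change of \<open>J\<close> per unit of \<open>e\<close>.\<close>

lemma Lagrangian_perturb:
  fixes c0 ch b e :: real and c :: "real^3" and z \<phi> :: "(real^3) \<times> real \<Rightarrow> real"
    and a :: "3 \<Rightarrow> (real^3) \<times> real \<Rightarrow> real"
  assumes U: "open U" "(x, t) \<in> U"
    and z: "z differentiable at (x, t)" and a: "\<And>j. a j differentiable at (x, t)"
    and \<phi>: "\<phi> differentiable at (x, t)"
    and Z: "\<And>x t. Z x t = z (x, t)" and A: "\<And>j x t. A x t $ j = a j (x, t)"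
  defines "G \<equiv> (\<chi> i. Dx i \<phi> (x, t))" and "d \<equiv> (\<Sum>i\<in>UNIV. Dx i (a i) (x, t))"
    and "P \<equiv> (\<chi> j. Dt (a j) (x, t))"
    and "J \<equiv> c0 *\<^sub>R (\<chi> i. Dx i z (x, t)) + ch *\<^sub>R curlD a (x, t)"
  defines "N \<equiv> (c0 * b) *\<^sub>R G + ch *\<^sub>R cross3 G c"
  shows "Lagrangian c0 ch (\<lambda>x t. Z x t + e * (b * \<phi> (x, t))) (\<lambda>x t. A x t + e *\<^sub>R (\<phi> (x, t) *\<^sub>R c)) x t
   = Lagrangian c0 ch Z A x t
     + e * (Dt z (x, t) * (b * Dt \<phi> (x, t)) + Dt \<phi> (x, t) * (P \<bullet> c) - J \<bullet> N - ch\<^sup>2 * d * (G \<bullet> c))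
     + e\<^sup>2 * (1/2 * ((b * Dt \<phi> (x, t))\<^sup>2 + (norm (Dt \<phi> (x, t) *\<^sub>R c))\<^sup>2 - (norm N)\<^sup>2 - ch\<^sup>2 * (G \<bullet> c)\<^sup>2))"
proof -
  \<comment> \<open>Proved for every \<open>e\<close>, since the instance \<open>e = 0\<close> also
    supplies the unperturbed Lagrangian.\<close>
  have Lag: "Lagrangian c0 ch (\<lambda>x t. Z x t + e * (b * \<phi> (x, t))) (\<lambda>x t. A x t + e *\<^sub>R (\<phi> (x, t) *\<^sub>R c)) x t
    = 1/2 * ((Dt z (x, t) + e * (b * Dt \<phi> (x, t)))\<^sup>2 + (norm (P + e *\<^sub>R (Dt \<phi> (x, t) *\<^sub>R c)))\<^sup>2
        - (norm (J + e *\<^sub>R N))\<^sup>2 - ch\<^sup>2 * (d + e * (G \<bullet> c))\<^sup>2)" for e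
  proof -
    let ?z = "\<lambda>p. z p + (e * b) * \<phi> p" and ?a = "\<lambda>j p. a j p + e * c $ j * \<phi> p"
    have dz: "?z differentiable at (x, t)" and da: "\<And>j. ?a j differentiable at (x, t)"
      using z a \<phi> by auto
    have Dz: "D v ?z (x, t) = D v z (x, t) + e * b * D v \<phi> (x, t)" for v
      using z \<phi> by (simp add: D_add D_cmult)
    have Da: "D v (?a j) (x, t) = D v (a j) (x, t) + e * c $ j * D v \<phi> (x, t)" for v j
      using a \<phi> by (simp add: D_add D_cmult)
    have 1: "dt (\<lambda>x t. Z x t + e * (b * \<phi> (x, t))) x t = Dt z (x, t) + e * (b * Dt \<phi> (x, t))"
      using dt_eq_Dt[OF U dz, of "\<lambda>x t. Z x t + e * (b * \<phi> (x, t))"] by (simp add: Z Dz)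
    have 2: "dt (\<lambda>x t. A x t + e *\<^sub>R (\<phi> (x, t) *\<^sub>R c)) x t = P + e *\<^sub>R (Dt \<phi> (x, t) *\<^sub>R c)"
      by (subst dt_vec_eq_Dt[where f = ?a, OF U da]) (simp_all add: A Da P_def vec_eq_iff)
    have 3: "grad (\<lambda>y. Z y t + e * (b * \<phi> (y, t))) x = (\<chi> i. Dx i z (x, t)) + (e * b) *\<^sub>R G"
      by (subst grad_eq_Dx[OF U dz]) (simp_all add: Z Dz G_def vec_eq_iff)
    have 4: "curl (\<lambda>y. A y t + e *\<^sub>R (\<phi> (y, t) *\<^sub>R c)) x = curlD a (x, t) + e *\<^sub>R cross3 G c"
      by (subst curl_eq_curlD[where f = ?a, OF U da]) (simp_all add: A curlD_perturb[OF a \<phi>] G_def)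
    have 5: "div3 (\<lambda>y. A y t + e *\<^sub>R (\<phi> (y, t) *\<^sub>R c)) x = d + e * (G \<bullet> c)"
    proof -
      have "div3 (\<lambda>y. A y t + e *\<^sub>R (\<phi> (y, t) *\<^sub>R c)) x = (\<Sum>i\<in>UNIV. Dx i (?a i) (x, t))"
        by (rule div3_eq_Dx[OF U da]) (simp add: A)
      also have "\<dots> = d + e * (G \<bullet> c)"
        unfolding Da by (simp add: d_def G_def inner_vec_def sum.distrib sum_distrib_left mult_ac)
      finally show ?thesis .
    qed
    have "c0 *\<^sub>R ((\<chi> i. Dx i z (x, t)) + (e * b) *\<^sub>R G) + ch *\<^sub>R (curlD a (x, t) + e *\<^sub>R cross3 G c)
        = J + e *\<^sub>R N"
      by (simp add: J_def N_def scaleR_add_right mult.left_commute mult.commute)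
    then show ?thesis unfolding Lagrangian_def 1 2 3 4 5 by simp
  qed
  have Lag0: "Lagrangian c0 ch Z A x t
      = 1/2 * ((Dt z (x, t))\<^sup>2 + (norm P)\<^sup>2 - (norm J)\<^sup>2 - ch\<^sup>2 * d\<^sup>2)"
    using Lag[of 0] by simp
  have sq: "(norm (v + e *\<^sub>R w))\<^sup>2 = (norm v)\<^sup>2 + 2 * e * (v \<bullet> w) + e\<^sup>2 * (norm w)\<^sup>2" for v w :: "real^3"
    unfolding power2_norm_eq_inner
    by (simp add: inner_add inner_commute power2_eq_square algebra_simps)
  have inn: "P \<bullet> (Dt \<phi> (x, t) *\<^sub>R c) = Dt \<phi> (x, t) * (P \<bullet> c)" by simp
  show ?thesis
    unfolding Lag Lag0 sq inn
    by (simp add: power2_eq_square algebra_simps)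
qed

text \<open>The integral is the coefficient of \<open>e\<close> in the perturbed action, which is a
  genuine quadratic polynomial once all three coefficients are known to be integrable.\<close>

lemma Euler_Lagrange_weak:
  fixes z \<phi> :: "(real^3) \<times> real \<Rightarrow> real" and a :: "3 \<Rightarrow> (real^3) \<times> real \<Rightarrow> real"
  assumes U: "open U" "\<Omega> \<times> {t0..t1} \<subseteq> U"
    and z: "Ck_open 1 U z" and a: "\<And>j. Ck_open 1 U (a j)"
    and Z: "\<And>x t. Z x t = z (x, t)" and A: "\<And>j x t. A x t $ j = a j (x, t)"
    and fin: "finite_action c0 ch \<Omega> t0 t1 Z A"
    and EL: "Euler_Lagrange c0 ch \<Omega> t0 t1 Z A"
    and \<phi>: "test_function (interior (\<Omega> \<times> {t0<..<t1})) \<phi>"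
  shows "(LINT p|lborel. Dt z p * (b * Dt \<phi> p) + Dt \<phi> p * ((\<chi> j. Dt (a j) p) \<bullet> c)
     - (c0 *\<^sub>R (\<chi> i. Dx i z p) + ch *\<^sub>R curlD a p)
         \<bullet> ((c0 * b) *\<^sub>R (\<chi> i. Dx i \<phi> p) + ch *\<^sub>R cross3 (\<chi> i. Dx i \<phi> p) c)
     - ch\<^sup>2 * (\<Sum>i\<in>UNIV. Dx i (a i) p) * ((\<chi> i. Dx i \<phi> p) \<bullet> c)) = 0"
    (is "(LINT p|lborel. ?L1 p) = 0")
proof -
  let ?S = "\<Omega> \<times> {t0..t1}"
  define G where "G p = (\<chi> i. Dx i \<phi> p)" for p
  define N where "N p = (c0 * b) *\<^sub>R G p + ch *\<^sub>R cross3 (G p) c" for p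
  define L2 where "L2 p = 1/2 * ((b * Dt \<phi> p)\<^sup>2 + (norm (Dt \<phi> p *\<^sub>R c))\<^sup>2 - (norm (N p))\<^sup>2
      - ch\<^sup>2 * (G p \<bullet> c)\<^sup>2)" for p
  define L0 where "L0 = (\<lambda>(x, t). Lagrangian c0 ch Z A x t)"
  obtain K where K: "compact K" "K \<subseteq> interior (\<Omega> \<times> {t0<..<t1})" "\<And>p. p \<notin> K \<Longrightarrow> \<phi> p = 0"
    and smooth: "\<And>n. Ck_open n UNIV \<phi>"
    using test_functionD[OF \<phi>] by blast
  have KS: "K \<subseteq> ?S"
    using K(2) interior_subset[of "\<Omega> \<times> {t0<..<t1}"] by fastforce
  have D0: "D v \<phi> p = 0" if "p \<notin> K" for p v
    using D_eq_0_outside[OF compact_imp_closed[OF K(1)] K(3) that] .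
  have G0: "G p = 0" if "p \<notin> K" for p
    using D0[OF that] by (simp add: G_def vec_eq_iff)
  have \<phi>1: "Ck_open 1 UNIV \<phi>" by (rule smooth)
  have \<phi>diff: "\<phi> differentiable at p" for p
    by (rule Ck_open_differentiable[OF smooth UNIV_I])
  have contD: "continuous_on K (D v z)" "continuous_on K (D v (a j))" "continuous_on K (D v \<phi>)" for v j
  proof -
    have KU: "K \<subseteq> U" using KS U(2) by blast
    show "continuous_on K (D v z)" "continuous_on K (D v (a j))"
      by (rule continuous_on_subset[OF Ck_open_1_continuous_D[OF z] KU]
          continuous_on_subset[OF Ck_open_1_continuous_D[OF a] KU])+
    show "continuous_on K (D v \<phi>)"
      by (rule continuous_on_subset[OF Ck_open_1_continuous_D[OF \<phi>1] subset_UNIV])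
  qed
  have contG: "continuous_on K (\<lambda>p. \<chi> i. Dx i \<phi> p)" "continuous_on K (\<lambda>p. \<chi> i. Dx i z p)"
    "continuous_on K (\<lambda>p. \<chi> j. Dt (a j) p)"
    by (intro continuous_on_vec_lambda contD)+
  have int1: "integrable lborel ?L1"
  proof (rule integrable_compact_support[OF K(1)])
    show "continuous_on K ?L1"
      by (intro continuous_intros contD contG continuous_on_cross continuous_on_curlD)
    show "?L1 p = 0" if "p \<notin> K" for p
      using D0[OF that] G0[OF that] by (simp add: G_def)
  qed
  have int2: "integrable lborel L2"
  proof (rule integrable_compact_support[OF K(1)])
    show "continuous_on K L2"
      unfolding L2_def N_def G_def
      by (intro continuous_intros contD contG continuous_on_cross)
    show "L2 p = 0" if "p \<notin> K" for p
      using D0[OF that] G0[OF that] by (simp add: L2_def N_def)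
  qed
  have int0: "integrable lborel (\<lambda>p. indicator ?S p * L0 p)"
    using fin by (simp add: finite_action_def set_integrable_def L0_def)
  let ?Z = "\<lambda>e x t. Z x t + e * (b * \<phi> (x, t))" and ?A = "\<lambda>e x t. A x t + e *\<^sub>R (\<phi> (x, t) *\<^sub>R c)"
  \<comment> \<open>The indicator stays only on the unperturbed term: the other two coefficients
    already vanish off \<open>K\<close>, which lies inside the domain.\<close>
  have expand: "indicator ?S p * (\<lambda>(x, t). Lagrangian c0 ch (?Z e) (?A e) x t) p
      = indicator ?S p * L0 p + e * ?L1 p + e\<^sup>2 * L2 p" for e p
  proof (cases "p \<in> ?S")
    case True
    obtain x t where p: "p = (x, t)" by fastforce
    then have "(x, t) \<in> U" using True U(2) by blast
    moreover from this have "z differentiable at (x, t)" "a j differentiable at (x, t)" for j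
      using z a by auto
    ultimately show ?thesis
      using Lagrangian_perturb[OF U(1) _ _ _ \<phi>diff, of x t z a Z A c0 ch e b c] True
      by (simp add: p Z A L0_def L2_def N_def G_def)
  next
    case False
    then have "p \<notin> K" using KS by blast
    moreover have "(\<chi> i. 0) = (0 :: real^3)" by (simp add: vec_eq_iff)
    ultimately show ?thesis using False D0 G0 by (simp add: L2_def N_def)
  qed
  have "action c0 ch \<Omega> t0 t1 (?Z e) (?A e)
      = (LINT p|lborel. indicator ?S p * L0 p) + e * (LINT p|lborel. ?L1 p) + e\<^sup>2 * (LINT p|lborel. L2 p)" for e
  proof -
    \<comment> \<open>Perturbed fields have finite action too, so rewriting the action as a
      space-time integral is legitimate for every \<open>e\<close>.\<close>
    have "set_integrable lborel ?S (\<lambda>(x, t). Lagrangian c0 ch (?Z e) (?A e) x t)"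
      unfolding set_integrable_def real_scaleR_def expand using int0 int1 int2 by simp
    from action_eq_integral[OF this] show ?thesis
      unfolding expand using int0 int1 int2 by simp
  qed
  moreover have "((\<lambda>e. action c0 ch \<Omega> t0 t1 (?Z e) (?A e)) has_real_derivative 0) (at 0)"
  proof -
    have "test_function (interior (\<Omega> \<times> {t0<..<t1})) (\<lambda>(x, t). b * \<phi> (x, t))"
      "test_function (interior (\<Omega> \<times> {t0<..<t1})) (\<lambda>(x, t). \<phi> (x, t) *\<^sub>R c)"
      using test_function_linear[OF \<phi> bounded_linear_mult_right[of b]]
        test_function_linear[OF \<phi> bounded_linear_scaleR_left[of c]] by (simp_all add: case_prod_unfold)
    then show ?thesis
      by (rule EL[unfolded Euler_Lagrange_def, rule_format])
  qed
  ultimately show ?thesis by (rule quadratic_derivative_0)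
qed

text \<open>Cyclic symmetry of the triple product; it frees the gradient of the bump from the cross
  product, so that a flux can be read off.\<close>

lemma inner_cross3_permute: "x \<bullet> cross3 y w = y \<bullet> cross3 w x"
  by (simp add: cross3_simps)

text \<open>The weak equation says that the space-time field \<open>(wt, w)\<close> has zero weak
  divergence. Density and flux are parameters constrained on \<open>U\<close>, so each choice of
  \<open>b\<close> and \<open>c\<close> can supply simplified expressions.\<close>

lemma Euler_Lagrange_strong:
  fixes z :: "(real^3) \<times> real \<Rightarrow> real" and a :: "3 \<Rightarrow> (real^3) \<times> real \<Rightarrow> real"
  assumes U: "open U" "\<Omega> \<times> {t0..t1} \<subseteq> U"
    and z: "Ck_open 1 U z" and a: "\<And>j. Ck_open 1 U (a j)"
    and Z: "\<And>x t. Z x t = z (x, t)" and A: "\<And>j x t. A x t $ j = a j (x, t)"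
    and fin: "finite_action c0 ch \<Omega> t0 t1 Z A"
    and EL: "Euler_Lagrange c0 ch \<Omega> t0 t1 Z A"
    and wt: "Ck_open 1 U wt" "\<And>p. p \<in> U \<Longrightarrow> wt p = b * Dt z p + (\<Sum>j\<in>UNIV. c $ j * Dt (a j) p)"
    and w: "\<And>i. Ck_open 1 U (w i)"
      "\<And>i p. p \<in> U \<Longrightarrow> w i p = - (c0 * b * (c0 * Dx i z p + ch * curlD a p $ i)
         + ch * cross3 c (c0 *\<^sub>R (\<chi> i. Dx i z p) + ch *\<^sub>R curlD a p) $ i
         + ch\<^sup>2 * (\<Sum>j\<in>UNIV. Dx j (a j) p) * c $ i)"
    and p: "p \<in> interior (\<Omega> \<times> {t0<..<t1})"
  shows "Dt wt p + (\<Sum>i\<in>UNIV. Dx i (w i) p) = 0"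
proof -
  let ?V = "interior (\<Omega> \<times> {t0<..<t1})"
  have VU: "?V \<subseteq> U" using interior_subset[of "\<Omega> \<times> {t0<..<t1}"] U(2) by fastforce
  \<comment> \<open>The index type \<open>3 option\<close> encodes the four directions:
    \<open>None\<close> is time, \<open>Some i\<close> is the i-th space axis.\<close>
  let ?w = "case_option wt w" and ?v = "case_option (0, 1) (\<lambda>i. (axis i 1, 0)) :: 3 option \<Rightarrow> (real^3) \<times> real"
  have sum_opt: "(\<Sum>i\<in>UNIV. f i) = f None + (\<Sum>i\<in>UNIV. f (Some i))" for f :: "3 option \<Rightarrow> real"
    by (simp add: UNIV_option_conv sum.insert sum.reindex)
  have "(\<Sum>i\<in>UNIV. D (?v i) (?w i) p) = 0"
  proof (rule weak_divergence_eq_0[OF _ _ _ p])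
    show "Ck_open 1 ?V (?w i)" for i
      using wt(1) w(1) VU by (auto split: option.split intro: Ck_open_subset simp del: One_nat_def Ck_open.simps)
    fix \<phi> :: "(real^3) \<times> real \<Rightarrow> real" assume \<phi>: "test_function ?V \<phi>"
    obtain K where K: "compact K" "K \<subseteq> ?V" "\<And>p. p \<notin> K \<Longrightarrow> \<phi> p = 0"
      and "\<And>n. Ck_open n UNIV \<phi>"
      using test_functionD[OF \<phi>] by blast
    have "(\<Sum>i\<in>UNIV. ?w i p * D (?v i) \<phi> p)
      = Dt z p * (b * Dt \<phi> p) + Dt \<phi> p * ((\<chi> j. Dt (a j) p) \<bullet> c)
     - (c0 *\<^sub>R (\<chi> i. Dx i z p) + ch *\<^sub>R curlD a p)
         \<bullet> ((c0 * b) *\<^sub>R (\<chi> i. Dx i \<phi> p) + ch *\<^sub>R cross3 (\<chi> i. Dx i \<phi> p) c)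
     - ch\<^sup>2 * (\<Sum>i\<in>UNIV. Dx i (a i) p) * ((\<chi> i. Dx i \<phi> p) \<bullet> c)" for p
    \<comment> \<open>The formulas for \<open>wt\<close> and \<open>w\<close> are available on
      \<open>U\<close> only, which covers \<open>K\<close>; off \<open>K\<close> both sides vanish
      with the derivatives of the bump.\<close>
    proof (cases "p \<in> K")
      case True
      then have pU: "p \<in> U" using K(2) VU by blast
      define G where "G = (\<chi> i. Dx i \<phi> p)"
      define J where "J = c0 *\<^sub>R (\<chi> i. Dx i z p) + ch *\<^sub>R curlD a p"
      define d where "d = (\<Sum>j\<in>UNIV. Dx j (a j) p)"
      have "w i p = - (c0 * b * J $ i + ch * cross3 c J $ i + ch\<^sup>2 * d * c $ i)" for i
        using w(2)[OF pU] by (simp add: J_def d_def)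
      then have "w i p * Dx i \<phi> p = - ((c0 * b * J $ i + ch * cross3 c J $ i + ch\<^sup>2 * d * c $ i) * G $ i)" for i
        by (simp only: G_def vec_lambda_beta mult_minus_left)
      then have "(\<Sum>i\<in>UNIV. w i p * Dx i \<phi> p)
          = - (\<Sum>i\<in>UNIV. (c0 * b * J $ i + ch * cross3 c J $ i + ch\<^sup>2 * d * c $ i) * G $ i)"
        by (simp only: sum_negf)
      also have "\<dots> = - (c0 * b * (J \<bullet> G) + ch * (G \<bullet> cross3 c J) + ch\<^sup>2 * d * (G \<bullet> c))"
        by (simp add: inner_vec_def sum.distrib sum_distrib_left algebra_simps)
      also have "\<dots> = - (J \<bullet> ((c0 * b) *\<^sub>R G + ch *\<^sub>R cross3 G c)) - ch\<^sup>2 * d * (G \<bullet> c)"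
        by (simp add: inner_add inner_cross3_permute[of J G c])
      finally show ?thesis
        using wt(2)[OF pU]
        by (simp add: sum_opt G_def J_def d_def inner_vec_def sum_distrib_left sum_distrib_right algebra_simps)
    next
      case False
      then have D0: "D v \<phi> p = 0" for v
        using D_eq_0_outside[OF compact_imp_closed[OF K(1)], of \<phi> p v] K(3) False by blast
      have "(\<chi> i. Dx i \<phi> p) = 0" by (simp add: D0 vec_eq_iff)
      then show ?thesis by (simp add: D0 sum_opt)
    qed
    then show "(LINT p|lborel. (\<Sum>i\<in>UNIV. ?w i p * D (?v i) \<phi> p)) = 0"
      using Euler_Lagrange_weak[OF U z a Z A fin EL \<phi>, of b c] by simp
  qed simp
  then show ?thesis by (simp add: sum_opt)
qed

section \<open>The field equations\<close>

lemma continuous_zero_on_closure: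
  fixes f :: "'a::metric_space \<Rightarrow> real"
  assumes "open U" "continuous_on U f" "\<And>q. q \<in> V \<Longrightarrow> f q = 0" "p \<in> U" "p \<in> closure V"
  shows "f p = 0"
proof (rule ccontr)
  assume "f p \<noteq> 0"
  then obtain r where "r > 0" "\<And>q. q \<in> ball p r \<Longrightarrow> \<bar>f q - f p\<bar> < \<bar>f p\<bar>"
    using continuous_on_open_near[OF assms(1,2,4), of "\<bar>f p\<bar>"] by auto
  moreover obtain q where "q \<in> V" "dist q p < r"
    using assms(5) \<open>r > 0\<close> unfolding closure_approachable by blast
  ultimately show False using assms(3)[of q] by (fastforce simp: dist_commute)
qed

text \<open>Interior and closure commute with products, and \<open>t0 < t1\<close> makes the closed
  interval the closure of the open one.\<close>

lemma Times_subset_closure_interior: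
  fixes \<Omega> :: "'a::euclidean_space set" and t0 t1 :: real
  assumes "t0 < t1" "\<Omega> \<subseteq> closure (interior \<Omega>)"
  shows "\<Omega> \<times> {t0..t1} \<subseteq> closure (interior (\<Omega> \<times> {t0<..<t1}))"
proof -
  have "closure {t0<..<t1} = {t0..t1}" using assms(1) by simp
  then show ?thesis using assms(2) by (auto simp: interior_Times closure_Times interior_open)
qed

lemma Ck_open_sum:
  assumes "open U" "\<And>i. i \<in> I \<Longrightarrow> Ck_open n U (f i)"
  shows "Ck_open n U (\<lambda>p. \<Sum>i\<in>I. f i p)"
  using assms(2)
proof (induction I rule: infinite_finite_induct)
  case (insert i I)
  then show ?case using Ck_open_add[OF assms(1), of n "f i"] by simp
qed (simp_all add: Ck_open_const)

lemma Ck_open_curlD: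
  assumes "open U" "\<And>i j. Ck_open n U (Dx i (f j))"
  shows "Ck_open n U (\<lambda>p. curlD f p $ i)"
  using exhaust_3[of i] by (auto simp: curlD_def intro!: Ck_open_sub assms)

lemma C1_differentiable: "Ck_open 1 U f \<Longrightarrow> p \<in> U \<Longrightarrow> f differentiable at p"
  by simp

lemma D_minus: "f differentiable at p \<Longrightarrow> D v (\<lambda>p. - f p) p = - D v f p" for f :: "_ \<Rightarrow> real"
  by (rule D_eqI, rule has_derivative_minus; rule has_derivative_D)

lemma curlD_minus:
  assumes "\<And>j. f j differentiable at p"
  shows "curlD (\<lambda>j p. - f j p) p = - curlD f p"
  using assms by (simp add: curlD_def D_minus vec_eq_iff forall_3)

text \<open>\<open>Z\<close> and \<open>A\<close> are the curried fields that the action takes;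
  \<open>z\<close> and \<open>a j\<close> are the same data as scalar functions on space-time, with
  one neighbourhood \<open>U\<close> for all of them.\<close>

locale heat_GLM_potentials =
  fixes c0 ch t0 t1 :: real and \<Omega> :: "(real^3) set" and U :: "((real^3) \<times> real) set"
    and z :: "(real^3) \<times> real \<Rightarrow> real" and a :: "3 \<Rightarrow> (real^3) \<times> real \<Rightarrow> real"
    and Z :: "real^3 \<Rightarrow> real \<Rightarrow> real" and A :: "real^3 \<Rightarrow> real \<Rightarrow> real^3"
  assumes t01: "t0 < t1" and \<Omega>: "\<Omega> \<subseteq> closure (interior \<Omega>)"
    and U: "open U" "\<Omega> \<times> {t0..t1} \<subseteq> U"
    and z2: "Ck_open 2 U z" and a2: "\<And>j. Ck_open 2 U (a j)"
    and Z: "\<And>x t. Z x t = z (x, t)" and A: "\<And>j x t. A x t $ j = a j (x, t)"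
    and fin: "finite_action c0 ch \<Omega> t0 t1 Z A"
    and EL: "Euler_Lagrange c0 ch \<Omega> t0 t1 Z A"
begin

definition Jf :: "3 \<Rightarrow> (real^3) \<times> real \<Rightarrow> real" where
  "Jf i p = c0 * Dx i z p + ch * curlD a p $ i"

definition diva :: "(real^3) \<times> real \<Rightarrow> real" where
  "diva p = (\<Sum>j\<in>UNIV. Dx j (a j) p)"

lemma z1: "Ck_open 1 U z" and a1: "Ck_open 1 U (a j)"
  using z2 a2[of j] Ck_open_SucD by (metis Suc_1)+

lemma Dz1: "Ck_open 1 U (D v z)" and Da1: "Ck_open 1 U (D v (a j))"
  using z2 a2[of j] Ck_open_D by (metis Suc_1)+

lemma Jf1: "Ck_open 1 U (Jf i)"
  unfolding Jf_def
  by (intro Ck_open_add Ck_open_cmult Ck_open_curlD Dz1 Da1 U(1))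

lemma diva1: "Ck_open 1 U diva"
  unfolding diva_def by (intro Ck_open_sum Da1 U(1))

lemmas diffs = C1_differentiable[OF z1] C1_differentiable[OF a1] C1_differentiable[OF Dz1]
  C1_differentiable[OF Da1] C1_differentiable[OF Jf1] C1_differentiable[OF diva1]

lemma J_vec: "c0 *\<^sub>R (\<chi> i. Dx i z p) + ch *\<^sub>R curlD a p = (\<chi> i. Jf i p)"
  by (simp add: vec_eq_iff Jf_def)

text \<open>The divergence is continuous on \<open>U\<close> because density and flux are C1; it
  vanishes on the interior, whose closure contains the whole domain.\<close>

lemma EL_closed:
  assumes wt: "Ck_open 1 U wt" "\<And>p. p \<in> U \<Longrightarrow> wt p = b * Dt z p + (\<Sum>j\<in>UNIV. c $ j * Dt (a j) p)"
    and w: "\<And>i. Ck_open 1 U (w i)"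
      "\<And>i p. p \<in> U \<Longrightarrow> w i p = - (c0 * b * Jf i p + ch * cross3 c (\<chi> i. Jf i p) $ i + ch\<^sup>2 * diva p * c $ i)"
    and p: "p \<in> \<Omega> \<times> {t0..t1}"
  shows "Dt wt p + (\<Sum>i\<in>UNIV. Dx i (w i) p) = 0"
proof (rule continuous_zero_on_closure[OF U(1)])
  show "continuous_on U (\<lambda>p. Dt wt p + (\<Sum>i\<in>UNIV. Dx i (w i) p))"
    by (intro continuous_on_add continuous_on_sum Ck_open_1_continuous_D wt(1) w(1))
  show "p \<in> U" "p \<in> closure (interior (\<Omega> \<times> {t0<..<t1}))"
    using p U(2) Times_subset_closure_interior[OF t01 \<Omega>] by blast+
  fix q assume "q \<in> interior (\<Omega> \<times> {t0<..<t1})"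
  then show "Dt wt q + (\<Sum>i\<in>UNIV. Dx i (w i) q) = 0"
    by (rule Euler_Lagrange_strong[OF U z1 a1 Z A fin EL wt w(1), rotated -1])
       (use w(2) in \<open>simp_all add: J_vec flip: Jf_def diva_def\<close>)
qed

text \<open>Varying \<open>Z\<close> alone gives the density Z_t and the flux - c0 J.\<close>

lemma wave_z:
  assumes p: "p \<in> \<Omega> \<times> {t0..t1}"
  shows "Dt (Dt z) p = c0 * (\<Sum>i\<in>UNIV. Dx i (Jf i) p)"
proof -
  have "Dt (Dt z) p + (\<Sum>i\<in>UNIV. Dx i (\<lambda>p. - c0 * Jf i p) p) = 0"
    by (rule EL_closed[where b = 1 and c = 0, OF _ _ _ _ p])
       (use Ck_open_cmult[OF U(1) Jf1, of "- c0"] in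
        \<open>auto intro: Dz1 simp del: One_nat_def Ck_open.simps\<close>)
  moreover have "Dx i (\<lambda>p. - c0 * Jf i p) p = - c0 * Dx i (Jf i) p" for i
    by (rule D_cmult) (use p U(2) in \<open>blast intro: diffs\<close>)
  ultimately show ?thesis by (simp add: sum_negf sum_distrib_left)
qed

text \<open>Varying only the \<open>k\<close>-th component of \<open>A\<close> gives the density
  A_t,k and the flux - ch (e_k x J) - ch^2 (div A) e_k; since e_k is constant, div (e_k x J) = -
  (curl J)_k.\<close>

lemma wave_a:
  assumes p: "p \<in> \<Omega> \<times> {t0..t1}"
  shows "Dt (Dt (a k)) p = - ch * curlD Jf p $ k + ch\<^sup>2 * Dx k diva p"
proof -
  \<comment> \<open>The flux as a sum of constant multiples, so that its regularity and its
    derivative can be taken term by term.\<close>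
  let ?w = "\<lambda>i p. (- ch) * cross3 (axis k 1) (\<chi> i. Jf i p) $ i + (- ch\<^sup>2 * axis k 1 $ i) * diva p"
  have pU: "p \<in> U" using p U(2) by blast
  have cross: "Ck_open 1 U (\<lambda>p. cross3 (axis k 1) (\<chi> i. Jf i p) $ i)" for i
    using exhaust_3[of i] 
    by (auto simp: cross3_def simp del: One_nat_def Ck_open.simps
        intro!: Ck_open_sub Ck_open_cmult U(1) Jf1)
  have "Dt (Dt (a k)) p + (\<Sum>i\<in>UNIV. Dx i (?w i) p) = 0"
  proof (rule EL_closed[where b = 0 and c = "axis k 1", OF _ _ _ _ p])
    show "Ck_open 1 U (?w i)" for i
      by (intro Ck_open_add Ck_open_cmult cross diva1 U(1))
    show "Dt (a k) q = 0 * Dt z q + (\<Sum>j\<in>UNIV. axis k 1 $ j * Dt (a j) q)" for q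
      by (simp add: axis_def if_distrib if_distribR cong: if_cong)
  qed (auto intro: Da1 simp: algebra_simps simp del: One_nat_def Ck_open.simps)
  moreover have "Dx i (?w i) p = (- ch) * Dx i (\<lambda>p. cross3 (axis k 1) (\<chi> i. Jf i p) $ i) p
      + (- ch\<^sup>2 * axis k 1 $ i) * Dx i diva p" for i
    by (rule D_eqI, rule has_derivative_add; rule has_derivative_mult_right; rule has_derivative_D)
       (fact C1_differentiable[OF cross pU] diffs(6)[OF pU])+
  moreover have "(\<Sum>i\<in>UNIV. Dx i (\<lambda>p. cross3 (axis k 1) (\<chi> i. Jf i p) $ i) p) = - curlD Jf p $ k"
    using exhaust_3[of k] diffs(5)[OF pU]
    by (auto simp: sum_3 cross3_def curlD_def axis_def D_diff D_cmult)
  ultimately have "Dt (Dt (a k)) p + (- ch) * (- curlD Jf p $ k)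
      + (\<Sum>i\<in>UNIV. (- ch\<^sup>2 * axis k 1 $ i) * Dx i diva p) = 0"
    by (simp only: sum.distrib add.assoc flip: sum_distrib_left)
  moreover have "(\<Sum>i\<in>UNIV. (- ch\<^sup>2 * axis k 1 $ i) * Dx i diva p) = - ch\<^sup>2 * Dx k diva p"
    by (simp add: axis_def if_distrib if_distribR cong: if_cong)
  ultimately show ?thesis by simp
qed

section \<open>Compatibility equations from commuting derivatives\<close>

lemma Dt_Jf:
  assumes p: "p \<in> U"
  shows "Dt (Jf k) p = c0 * Dx k (Dt z) p + ch * curlD (\<lambda>j. Dt (a j)) p $ k"
proof -
  have comm: "Dt (Dx i z) p = Dx i (Dt z) p" "Dt (Dx i (a j)) p = Dx i (Dt (a j)) p" for i j
    by (rule mixed_derivatives_commute[OF U(1) p z2] mixed_derivatives_commute[OF U(1) p a2])+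
  have cd: "(\<lambda>p. curlD a p $ k) differentiable at p"
    by (intro C1_differentiable[OF _ p] Ck_open_curlD U(1) Da1)
  have "Dt (\<lambda>p. curlD a p $ k) p = curlD (\<lambda>j. Dt (a j)) p $ k"
    using exhaust_3[of k] diffs(4)[OF p]
    by (auto simp: curlD_def D_diff comm)
  then show ?thesis
    unfolding Jf_def using diffs(3)[OF p] cd by (simp add: D_add D_cmult comm)
qed

lemma Dt_diva:
  assumes p: "p \<in> U"
  shows "Dt diva p = (\<Sum>i\<in>UNIV. Dx i (Dt (a i)) p)"
  unfolding diva_def
  using diffs(4)[OF p] mixed_derivatives_commute[OF U(1) p a2]
  by (subst D_sum) auto

text \<open>This and the next three identities are stated at all points of \<open>U\<close>, since
  both sides are to be differentiated once more.\<close>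

lemma field_J:
  assumes "(x, t) \<in> U"
  shows "(c0 *\<^sub>R grad (\<lambda>y. Z y t) x + ch *\<^sub>R curl (\<lambda>y. A y t) x) $ i = Jf i (x, t)"
  using grad_eq_Dx[OF U(1) assms diffs(1)[OF assms], of "\<lambda>y. Z y t"]
    curl_eq_curlD[OF U(1) assms, of a "\<lambda>y. A y t"] diffs(2)[OF assms]
  by (simp add: Z A Jf_def)

lemma field_\<phi>:
  assumes "(x, t) \<in> U"
  shows "div3 (\<lambda>y. A y t) x = diva (x, t)"
  unfolding diva_def by (rule div3_eq_Dx[OF U(1) assms]) (auto simp: A intro: diffs(2)[OF assms])

lemma field_T:
  assumes "(x, t) \<in> U"
  shows "dt Z x t = Dt z (x, t)"
  by (rule dt_eq_Dt[OF U(1) assms diffs(1)[OF assms]]) (simp add: Z)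

lemma field_\<psi>:
  assumes "(x, t) \<in> U"
  shows "dt A x t $ j = Dt (a j) (x, t)"
  by (subst dt_vec_eq_Dt[where f = a, OF U(1) assms]) (auto simp: A intro: diffs(2)[OF assms])

lemma heat_GLM:
  assumes xt: "x \<in> \<Omega>" "t \<in> {t0..t1}"
  defines "T \<equiv> \<lambda>x t. - dt Z x t" and "\<psi> \<equiv> \<lambda>x t. - dt A x t"
    and "J \<equiv> \<lambda>x t. c0 *\<^sub>R grad (\<lambda>y. Z y t) x + ch *\<^sub>R curl (\<lambda>y. A y t) x"
    and "\<phi> \<equiv> \<lambda>x t. ch * div3 (\<lambda>y. A y t) x"
  shows "dt T x t + c0 * div3 (\<lambda>y. J y t) x = 0"
    and "dt J x t + c0 *\<^sub>R grad (\<lambda>y. T y t) x + ch *\<^sub>R curl (\<lambda>y. \<psi> y t) x = 0"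
    and "dt \<psi> x t - ch *\<^sub>R curl (\<lambda>y. J y t) x + ch *\<^sub>R grad (\<lambda>y. \<phi> y t) x = 0"
    and "dt \<phi> x t + ch * div3 (\<lambda>y. \<psi> y t) x = 0"
proof -
  have p: "(x, t) \<in> \<Omega> \<times> {t0..t1}" using xt by simp
  then have pU: "(x, t) \<in> U" using U(2) by blast
  note d = diffs(1-6)[OF pU]
  \<comment> \<open>Differentiability of the functions that represent \<open>T\<close>, the
    components of \<open>\<psi>\<close>, and \<open>\<phi>\<close> on \<open>U\<close>.\<close>
  have d': "(\<lambda>p. - Dt z p) differentiable at (x, t)" "(\<lambda>p. - Dt (a j) p) differentiable at (x, t)"
    "(\<lambda>p. ch * diva p) differentiable at (x, t)" for j
    using d by auto
  have T: "dt T x t = - Dt (Dt z) (x, t)" "grad (\<lambda>y. T y t) x = - (\<chi> i. Dx i (Dt z) (x, t))"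
    using dt_eq_Dt[OF U(1) pU d'(1), of T] grad_eq_Dx[OF U(1) pU d'(1), of "\<lambda>y. T y t"] d
    by (simp_all add: T_def field_T D_minus vec_eq_iff)
  have \<psi>: "dt \<psi> x t = - (\<chi> j. Dt (Dt (a j)) (x, t))"
    "curl (\<lambda>y. \<psi> y t) x = - curlD (\<lambda>j. Dt (a j)) (x, t)"
    "div3 (\<lambda>y. \<psi> y t) x = - (\<Sum>i\<in>UNIV. Dx i (Dt (a i)) (x, t))"
    using dt_vec_eq_Dt[OF U(1) pU d'(2), of \<psi>] curl_eq_curlD[OF U(1) pU d'(2), of "\<lambda>y. \<psi> y t"]
      div3_eq_Dx[OF U(1) pU d'(2), of "\<lambda>y. \<psi> y t"] d
    by (simp_all add: \<psi>_def field_\<psi> D_minus curlD_minus vec_eq_iff sum_negf)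
  have J: "dt J x t = (\<chi> j. Dt (Jf j) (x, t))" "curl (\<lambda>y. J y t) x = curlD Jf (x, t)"
    "div3 (\<lambda>y. J y t) x = (\<Sum>i\<in>UNIV. Dx i (Jf i) (x, t))"
    using dt_vec_eq_Dt[OF U(1) pU d(5), of J] curl_eq_curlD[OF U(1) pU d(5), of "\<lambda>y. J y t"]
      div3_eq_Dx[OF U(1) pU d(5), of "\<lambda>y. J y t"] field_J
    by (simp_all add: J_def)
  have \<phi>: "dt \<phi> x t = ch * Dt diva (x, t)" "grad (\<lambda>y. \<phi> y t) x = ch *\<^sub>R (\<chi> i. Dx i diva (x, t))"
    using dt_eq_Dt[OF U(1) pU d'(3), of \<phi>] grad_eq_Dx[OF U(1) pU d'(3), of "\<lambda>y. \<phi> y t"] d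
    by (simp_all add: \<phi>_def field_\<phi> D_cmult vec_eq_iff)
  \<comment> \<open>The minus signs in \<open>T\<close> and \<open>\<psi>\<close> turn the two wave
    equations into the first and third equations, and the two compatibility equations into the
    second and fourth.\<close>
  show "dt T x t + c0 * div3 (\<lambda>y. J y t) x = 0"
    by (simp add: T J wave_z[OF p])
  show "dt J x t + c0 *\<^sub>R grad (\<lambda>y. T y t) x + ch *\<^sub>R curl (\<lambda>y. \<psi> y t) x = 0"
    by (simp add: T J \<psi> Dt_Jf[OF pU] vec_eq_iff)
  show "dt \<psi> x t - ch *\<^sub>R curl (\<lambda>y. J y t) x + ch *\<^sub>R grad (\<lambda>y. \<phi> y t) x = 0"
    by (simp add: \<phi> J \<psi> wave_a[OF p] vec_eq_iff power2_eq_square)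
  show "dt \<phi> x t + ch * div3 (\<lambda>y. \<psi> y t) x = 0"
    by (simp add: \<phi> \<psi> Dt_diva[OF pU])
qed

end

theorem mainTheorem1:
  fixes c0 ch t0 t1 :: real
    and \<Omega> :: "(real^3) set"
    and Z T \<phi> :: "real^3 \<Rightarrow> real \<Rightarrow> real"
    and A J \<psi> :: "real^3 \<Rightarrow> real \<Rightarrow> real^3"
  assumes "t0 < t1"
    and "\<Omega> \<subseteq> closure (interior \<Omega>)"
    and "Ck_on 2 (\<Omega> \<times> {t0..t1}) (\<lambda>(x, t). Z x t)"
    and "Ck_on 2 (\<Omega> \<times> {t0..t1}) (\<lambda>(x, t). A x t)"
    and "finite_action c0 ch \<Omega> t0 t1 Z A"
    and "Euler_Lagrange c0 ch \<Omega> t0 t1 Z A"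
    and "T = (\<lambda>x t. - dt Z x t)"
    and "\<psi> = (\<lambda>x t. - dt A x t)"
    and "J = (\<lambda>x t. c0 *\<^sub>R grad (\<lambda>y. Z y t) x + ch *\<^sub>R curl (\<lambda>y. A y t) x)"
    and "\<phi> = (\<lambda>x t. ch * div3 (\<lambda>y. A y t) x)"
  shows "\<forall>x\<in>\<Omega>. \<forall>t\<in>{t0..t1}.
      dt T x t + c0 * div3 (\<lambda>y. J y t) x = 0 \<and>
      dt J x t + c0 *\<^sub>R grad (\<lambda>y. T y t) x + ch *\<^sub>R curl (\<lambda>y. \<psi> y t) x = 0 \<and>
      dt \<psi> x t - ch *\<^sub>R curl (\<lambda>y. J y t) x + ch *\<^sub>R grad (\<lambda>y. \<phi> y t) x = 0 \<and>
      dt \<phi> x t + ch * div3 (\<lambda>y. \<psi> y t) x = 0"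
proof -
  obtain UZ UA where UZ: "open UZ" "\<Omega> \<times> {t0..t1} \<subseteq> UZ" "Ck_open 2 UZ (\<lambda>(x, t). Z x t)"
    and UA: "open UA" "\<Omega> \<times> {t0..t1} \<subseteq> UA" "Ck_open 2 UA (\<lambda>(x, t). A x t)"
    using assms(3,4) unfolding Ck_on_def by auto
  \<comment> \<open>Each field comes with its own neighbourhood; the intersection is open and still
    contains the domain.\<close>
  interpret heat_GLM_potentials c0 ch t0 t1 \<Omega> "UZ \<inter> UA" "\<lambda>(x, t). Z x t" "\<lambda>j p. (\<lambda>(x, t). A x t) p $ j" Z A
  proof
    show "Ck_open 2 (UZ \<inter> UA) (\<lambda>(x, t). Z x t)"
      by (rule Ck_open_subset[OF UZ(3)]) simp
    show "Ck_open 2 (UZ \<inter> UA) (\<lambda>p. (\<lambda>(x, t). A x t) p $ j)" for j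
      by (rule Ck_open_subset[OF Ck_open_bounded_linear[OF bounded_linear_vec_nth UA(1,3)]]) simp
  qed (use assms UZ UA in auto)
  show ?thesis
    unfolding assms(7-10) using heat_GLM by blast
qed

end
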